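(* Equip $\mathbb{R}^n$ with its standard inner product and orientation, and let $\star$ be the Hodge star. The following maps satisfy $c_n(v)c_n(w)+c_n(w)c_n(v)=-2\langle v,w\rangle$ for all $v,w\in\mathbb{R}^n$ and make the indicated spaces irreducible $C\ell_n$-modules. (1) For $n=1$ and $n=2$: the space $\wedge_{\mathbb{R}}\mathbb{R}^n$ with $c_n(v)=v\wedge-\iota_v$. (2) For $n=3$: the space $\wedge^0\mathbb{R}^3\oplus\wedge^1\mathbb{R}^3$ with $$c_3(v)(\lambda,w)=\bigl(-\langle v,w\rangle,\ \lambda v+\star(v\wedge w)\bigr).$$ (3) For $n=4$: the space $\wedge^0\mathbb{R}^4\oplus\wedge^1\mathbb{R}^4\oplus\wedge^-\mathbb{R}^4$ with $$c_4(v)(\lambda,w,\tau)=\bigl(-\langle v,w\rangle,\ \lambda v+\star(v\wedge\tau)-\iota_v\tau,\ P_{\wedge^-}(v\wedge w)\bigr),$$ where $\wedge^-\mathbb{R}^4=\{\tau\in\wedge^2\mathbb{R}^4:\star\tau=-\tau\}$ and $P_{\wedge^-}:\wedge^2\mathbb{R}^4\to\wedge^-\mathbb{R}^4$ is the orthogonal projection.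
   Context: $C\ell_n$ is the unital real Clifford algebra of Euclidean $\mathbb{R}^n$ with relations $v\cdot w+w\cdot v=-2\langle v,w\rangle$; a linear map $c_n$ satisfying the displayed identity extends uniquely to a $C\ell_n$-module structure. $\iota_v$ denotes contraction (interior product) with $v$ using the inner product, and $v\wedge$ denotes left exterior multiplication. Vectors and $1$-(multi)vectors are identified, $\wedge^1\mathbb{R}^n=\mathbb{R}^n$, $\wedge^0\mathbb{R}^n=\mathbb{R}$. *)

theory Defs
  imports "HOL-Analysis.Analysis"
begin

text \<open>Euclidean space of dimension \<open>n\<close> is \<open>real ^ 'n\<close> for an arbitrary linearly ordered index type
  with \<open>CARD('n) = n\<close>. Its standard orientation is the one for which the coordinate basis, listed in
  increasing order of the indices, is positive. (In the numeral type \<open>4\<close> the index \<open>4 = 0\<close> comes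
  first; a statement about all \<open>'n\<close> with \<open>CARD('n) = 4\<close> does not depend on such a labelling.)\<close>


section \<open>The exterior algebra of \<open>real ^ 'n\<close>\<close>

text \<open>The coefficient \<open>\<omega> $ I\<close> belongs to \<open>e\<^sub>I = e\<^sub>i\<^sub>1 \<and> \<dots> \<and> e\<^sub>i\<^sub>k\<close>, where
  \<open>I = {i\<^sub>1 < \<dots> < i\<^sub>k}\<close>. The inner product of vectors indexed by \<open>'n set\<close> makes the
  \<open>e\<^sub>I\<close> orthonormal, which is the standard inner product on multivectors.\<close>

type_synonym 'n multivector = "(real, 'n set) vec"

definition grade :: "nat \<Rightarrow> ('n::{finite,linorder}) multivector set" where
  "grade k = {\<omega>. \<forall>I. \<omega> $ I \<noteq> 0 \<longrightarrow> card I = k}"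

definition vec_mv :: "real ^ ('n::{finite,linorder}) \<Rightarrow> 'n multivector" where
  "vec_mv v = (\<Sum>i\<in>UNIV. v $ i *\<^sub>R axis {i} 1)"

text \<open>The inverse of \<open>vec_mv\<close> on \<open>grade 1\<close>.\<close>
definition mv_vec :: "('n::{finite,linorder}) multivector \<Rightarrow> (real, 'n) vec" where
  "mv_vec \<omega> = (\<chi> i. \<omega> $ {i})"

text \<open>For disjoint \<open>I\<close> and \<open>J\<close>, \<open>e\<^sub>I \<and> e\<^sub>J = shuffle_sign I J *\<^sub>R e\<^sub>I\<^sub>\<union>\<^sub>J\<close>.\<close>
definition shuffle_sign :: "('n::{finite,linorder}) set \<Rightarrow> 'n set \<Rightarrow> real" where
  "shuffle_sign I J = (\<Prod>i\<in>I. \<Prod>j\<in>J. if j < i then -1 else 1)"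

definition wedge :: "('n::{finite,linorder}) multivector \<Rightarrow> 'n multivector \<Rightarrow> 'n multivector"
    (infixr "\<and>\<^sub>m" 70) where
  "\<omega> \<and>\<^sub>m \<eta> = (\<chi> K. \<Sum>I\<in>Pow K. shuffle_sign I (K - I) * \<omega> $ I * \<eta> $ (K - I))"

definition contract :: "real ^ ('n::{finite,linorder}) \<Rightarrow> 'n multivector \<Rightarrow> 'n multivector" where
  "contract v \<omega> = (\<chi> K. \<Sum>i\<in>-K. shuffle_sign {i} K * v $ i * \<omega> $ insert i K)"

definition hodge :: "('n::{finite,linorder}) multivector \<Rightarrow> 'n multivector" where
  "hodge \<omega> = (\<chi> K. shuffle_sign (-K) K * \<omega> $ (-K))"

definition anti_self_dual :: "('n::{finite,linorder}) multivector set" where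
  "anti_self_dual = {\<tau> \<in> grade 2. hodge \<tau> = - \<tau>}"

definition orth_proj :: "'a::euclidean_space set \<Rightarrow> 'a \<Rightarrow> 'a" where
  "orth_proj S x = (THE p. p \<in> S \<and> (\<forall>s\<in>S. orthogonal (x - p) s))"


section \<open>The Clifford algebra of \<open>real ^ 'n\<close>\<close>

text \<open>Again \<open>coeffs a $ I\<close> belongs to \<open>e\<^sub>I = e\<^sub>i\<^sub>1 \<cdots> e\<^sub>i\<^sub>k\<close>, \<open>I = {i\<^sub>1 < \<dots> < i\<^sub>k}\<close>. From
  \<open>e\<^sub>i e\<^sub>j = - e\<^sub>j e\<^sub>i\<close> for \<open>i \<noteq> j\<close> and \<open>e\<^sub>i e\<^sub>i = -1\<close>, the product \<open>e\<^sub>I e\<^sub>J\<close> is \<open>e\<^sub>K\<close> for the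
  symmetric difference \<open>K\<close> of \<open>I\<close> and \<open>J\<close>, with one sign for every \<open>i \<in> I\<close>, \<open>j \<in> J\<close> with
  \<open>j \<le> i\<close>. The universal property, in the form that every
  linear map satisfying the Clifford relations extends uniquely to a module structure, is proved in
  \<open>extends_to_module_exists\<close> and \<open>extends_to_module_unique\<close>.\<close>

typedef ('n::finite) clifford = "UNIV :: (real, 'n set) vec set"
  morphisms coeffs Clifford ..

setup_lifting type_definition_clifford

definition clifford_sign :: "('n::{finite,linorder}) set \<Rightarrow> 'n set \<Rightarrow> real" where
  "clifford_sign I J = (\<Prod>i\<in>I. \<Prod>j\<in>J. if j \<le> i then -1 else 1)"

lemma prod_sym_diff:
  fixes f :: "'a \<Rightarrow> real"
  assumes "finite A" "finite B" "\<And>x. f x * f x = 1"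
  shows "prod f (sym_diff A B) = prod f A * prod f B"
proof -
  have A: "prod f A = prod f (A - B) * prod f (A \<inter> B)"
    by (metis assms(1) prod.Int_Diff mult.commute)
  have B: "prod f B = prod f (B - A) * prod f (A \<inter> B)"
    by (metis assms(2) prod.Int_Diff mult.commute inf_commute)
  have "prod f (A \<inter> B) * prod f (A \<inter> B) = 1"
    by (simp add: prod.distrib[symmetric] assms)
  moreover have "prod f (sym_diff A B) = prod f (A - B) * prod f (B - A)"
    by (rule prod.union_disjoint) (use assms in auto)
  ultimately show ?thesis
    unfolding A B by (simp add: mult.assoc mult.left_commute)
qed

lemma clifford_sign_sym_diff_left:
  "clifford_sign (sym_diff I J) K = clifford_sign I K * clifford_sign J K"
  unfolding clifford_sign_def
  by (rule prod_sym_diff) (auto simp: prod.distrib[symmetric] intro!: prod.neutral)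

lemma clifford_sign_sym_diff_right:
  "clifford_sign I (sym_diff J K) = clifford_sign I J * clifford_sign I K"
  unfolding clifford_sign_def
  by (simp add: prod.distrib[symmetric] prod_sym_diff cong: prod.cong)

lemma clifford_sign_empty [simp]: "clifford_sign {} J = 1" "clifford_sign I {} = 1"
  by (simp_all add: clifford_sign_def)

lemma bij_sym_diff: "bij (sym_diff (I :: 'a set))"
  by (rule involuntory_imp_bij) auto

instantiation clifford :: ("{finite,linorder}") real_algebra_1
begin

lift_definition zero_clifford :: "'a clifford" is 0 .
lift_definition one_clifford :: "'a clifford" is "axis {} 1" .
lift_definition plus_clifford :: "'a clifford \<Rightarrow> 'a clifford \<Rightarrow> 'a clifford" is "(+)" .
lift_definition minus_clifford :: "'a clifford \<Rightarrow> 'a clifford \<Rightarrow> 'a clifford" is "(-)" .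
lift_definition uminus_clifford :: "'a clifford \<Rightarrow> 'a clifford" is uminus .
lift_definition scaleR_clifford :: "real \<Rightarrow> 'a clifford \<Rightarrow> 'a clifford" is "(*\<^sub>R)" .
lift_definition times_clifford :: "'a clifford \<Rightarrow> 'a clifford \<Rightarrow> 'a clifford" is
  "\<lambda>a b. \<chi> K. \<Sum>I\<in>UNIV. clifford_sign I (sym_diff I K) * a $ I * b $ sym_diff I K" .

instance
proof
  fix a b c :: "'a clifford" and r s :: real
  show "a + b + c = a + (b + c)" "a + b = b + a" "0 + a = a" "- a + a = 0" "a - b = a + - b"
    by (transfer, simp)+
  show "r *\<^sub>R (a + b) = r *\<^sub>R a + r *\<^sub>R b" "(r + s) *\<^sub>R a = r *\<^sub>R a + s *\<^sub>R a"
    "r *\<^sub>R s *\<^sub>R a = (r * s) *\<^sub>R a" "1 *\<^sub>R a = a"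
    by (transfer, simp add: algebra_simps)+
  show "(a + b) * c = a * c + b * c" "a * (b + c) = a * b + a * c"
    by (transfer, simp add: vec_eq_iff algebra_simps sum.distrib)+
  show "r *\<^sub>R a * b = r *\<^sub>R (a * b)" "a * r *\<^sub>R b = r *\<^sub>R (a * b)"
    by (transfer, simp add: vec_eq_iff algebra_simps sum_distrib_left)+
  show "(0 :: 'a clifford) \<noteq> 1"
    by transfer (simp add: axis_eq_0_iff)
  show "1 * a = a"
    by transfer (simp add: vec_eq_iff axis_def if_distrib if_distribR sum.delta cong: if_cong)
  show "a * 1 = a"
  proof transfer
    fix a :: "(real, 'a set) vec"
    have "(\<Sum>I\<in>UNIV. clifford_sign I (sym_diff I K) * a $ I * axis {} 1 $ sym_diff I K) = a $ K"
      for K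
    proof -
      have "(\<Sum>I\<in>UNIV. clifford_sign I (sym_diff I K) * a $ I * axis {} 1 $ sym_diff I K)
          = (\<Sum>I\<in>UNIV. if I = K then a $ I else 0)"
        by (rule sum.cong) (auto simp: axis_def)
      then show ?thesis by simp
    qed
    then show "(\<chi> K. \<Sum>I\<in>UNIV. clifford_sign I (sym_diff I K) * a $ I * axis {} 1 $ sym_diff I K) = a"
      by (simp add: vec_eq_iff)
  qed
  show "a * b * c = a * (b * c)"
  proof transfer
    fix a b c :: "(real, 'a set) vec"
    let ?m = "\<lambda>a b :: (real, 'a set) vec. \<chi> K. \<Sum>I\<in>UNIV.
      clifford_sign I (sym_diff I K) * a $ I * b $ sym_diff I K"
    have "?m (?m a b) c $ L = ?m a (?m b c) $ L" for L
    proof -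
      define t where "t I J = clifford_sign I (sym_diff I L) * a $ I *
        (clifford_sign J (sym_diff J (sym_diff I L)) * b $ J * c $ sym_diff J (sym_diff I L))" for I J
      have *: "clifford_sign K (sym_diff K L) *
            (clifford_sign I (sym_diff I K) * a $ I * b $ sym_diff I K) * c $ sym_diff K L
          = t I (sym_diff I K)" for I K
      proof -
        define J where "J = sym_diff I K"
        define X where "X = sym_diff K L"
        have [simp]: "K = sym_diff I J" "sym_diff I L = sym_diff J X"
          "sym_diff J (sym_diff J X) = X"
          unfolding J_def X_def by auto
        show ?thesis
          unfolding t_def J_def[symmetric] X_def[symmetric]
          by (simp only: \<open>sym_diff I L = _\<close> \<open>sym_diff J (sym_diff J X) = X\<close>)
             (subst \<open>K = _\<close>, simp only: clifford_sign_sym_diff_left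
              clifford_sign_sym_diff_right mult_ac)
      qed
      have "?m (?m a b) c $ L = (\<Sum>K\<in>UNIV. \<Sum>I\<in>UNIV. t I (sym_diff I K))"
        by (simp add: sum_distrib_left sum_distrib_right *)
      also have "\<dots> = (\<Sum>I\<in>UNIV. \<Sum>K\<in>UNIV. t I (sym_diff I K))"
        by (rule sum.swap)
      also have "\<dots> = (\<Sum>I\<in>UNIV. \<Sum>J\<in>UNIV. t I J)"
        by (intro sum.cong refl sum.reindex_bij_betw bij_sym_diff)
      also have "\<dots> = ?m a (?m b c) $ L"
        by (simp add: sum_distrib_left t_def)
      finally show ?thesis .
    qed
    then show "?m (?m a b) c = ?m a (?m b c)"
      by (simp add: vec_eq_iff)
  qed
qed

end

definition vec_clifford :: "real ^ ('n::{finite,linorder}) \<Rightarrow> 'n clifford" where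
  "vec_clifford v = Clifford (\<Sum>i\<in>UNIV. v $ i *\<^sub>R axis {i} 1)"


section \<open>Clifford modules\<close>

text \<open>A module structure over the Clifford algebra is a unital algebra homomorphism \<open>\<rho>\<close> into the
  linear endomorphisms of \<open>V\<close>; values of \<open>\<rho> a\<close> outside \<open>V\<close> are irrelevant.\<close>
definition clifford_module ::
    "'a::real_vector set \<Rightarrow> (('n::{finite,linorder}) clifford \<Rightarrow> 'a \<Rightarrow> 'a) \<Rightarrow> bool" where
  "clifford_module V \<rho> \<longleftrightarrow> subspace V \<and>
    (\<forall>a. \<forall>x\<in>V. \<rho> a x \<in> V) \<and>
    (\<forall>a. \<forall>x\<in>V. \<forall>y\<in>V. \<rho> a (x + y) = \<rho> a x + \<rho> a y) \<and>
    (\<forall>a r. \<forall>x\<in>V. \<rho> a (r *\<^sub>R x) = r *\<^sub>R \<rho> a x) \<and>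
    (\<forall>a b. \<forall>x\<in>V. \<rho> (a + b) x = \<rho> a x + \<rho> b x) \<and>
    (\<forall>a r. \<forall>x\<in>V. \<rho> (r *\<^sub>R a) x = r *\<^sub>R \<rho> a x) \<and>
    (\<forall>a b. \<forall>x\<in>V. \<rho> (a * b) x = \<rho> a (\<rho> b x)) \<and>
    (\<forall>x\<in>V. \<rho> 1 x = x)"

definition irreducible_clifford_module ::
    "'a::real_vector set \<Rightarrow> (('n::{finite,linorder}) clifford \<Rightarrow> 'a \<Rightarrow> 'a) \<Rightarrow> bool" where
  "irreducible_clifford_module V \<rho> \<longleftrightarrow> clifford_module V \<rho> \<and> V \<noteq> {0} \<and>
    (\<forall>W \<subseteq> V. subspace W \<and> (\<forall>a. \<forall>x\<in>W. \<rho> a x \<in> W) \<longrightarrow> W = {0} \<or> W = V)"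

definition extends_to_module ::
    "'a::real_vector set \<Rightarrow> (real ^ ('n::{finite,linorder}) \<Rightarrow> 'a \<Rightarrow> 'a) \<Rightarrow>
     ('n clifford \<Rightarrow> 'a \<Rightarrow> 'a) \<Rightarrow> bool" where
  "extends_to_module V c \<rho> \<longleftrightarrow> clifford_module V \<rho> \<and>
    (\<forall>v. \<forall>x\<in>V. \<rho> (vec_clifford v) x = c v x)"

definition clifford_map ::
    "'a::real_vector set \<Rightarrow> (real ^ ('n::{finite,linorder}) \<Rightarrow> 'a \<Rightarrow> 'a) \<Rightarrow> bool" where
  "clifford_map V c \<longleftrightarrow> subspace V \<and>
    (\<forall>v. \<forall>x\<in>V. c v x \<in> V) \<and>
    (\<forall>v. \<forall>x\<in>V. \<forall>y\<in>V. c v (x + y) = c v x + c v y) \<and>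
    (\<forall>v r. \<forall>x\<in>V. c v (r *\<^sub>R x) = r *\<^sub>R c v x) \<and>
    (\<forall>x\<in>V. linear (\<lambda>v. c v x)) \<and>
    (\<forall>v w. \<forall>x\<in>V. c v (c w x) + c w (c v x) = (- 2 * (v \<bullet> w)) *\<^sub>R x)"

text \<open>The structure \<open>\<rho>\<close> is unique on \<open>V\<close>, see \<open>extends_to_module_unique\<close> below.\<close>
definition makes_irreducible_module ::
    "'a::real_vector set \<Rightarrow> (real ^ ('n::{finite,linorder}) \<Rightarrow> 'a \<Rightarrow> 'a) \<Rightarrow> bool" where
  "makes_irreducible_module V c \<longleftrightarrow>
    (\<exists>\<rho>. extends_to_module V c \<rho>) \<and>
    (\<forall>\<rho>. extends_to_module V c \<rho> \<longrightarrow> irreducible_clifford_module V \<rho>)"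


section \<open>The maps \<open>c\<^sub>n\<close>\<close>

definition c12 :: "real ^ ('n::{finite,linorder}) \<Rightarrow> 'n multivector \<Rightarrow> 'n multivector" where
  "c12 v \<omega> = vec_mv v \<and>\<^sub>m \<omega> - contract v \<omega>"

definition c3 :: "real ^ ('n::{finite,linorder}) \<Rightarrow> real \<times> (real, 'n) vec \<Rightarrow> real \<times> (real, 'n) vec" where
  "c3 v = (\<lambda>(a, w). (- (v \<bullet> w), a *\<^sub>R v + mv_vec (hodge (vec_mv v \<and>\<^sub>m vec_mv w))))"

definition c4 :: "real ^ ('n::{finite,linorder}) \<Rightarrow> real \<times> (real, 'n) vec \<times> 'n multivector
    \<Rightarrow> real \<times> (real, 'n) vec \<times> 'n multivector" where
  "c4 v = (\<lambda>(a, w, \<tau>). (- (v \<bullet> w),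
    a *\<^sub>R v + mv_vec (hodge (vec_mv v \<and>\<^sub>m \<tau>) - contract v \<tau>),
    orth_proj anti_self_dual (vec_mv v \<and>\<^sub>m vec_mv w)))"


section \<open>Basic facts confirming the definitions\<close>

lemma vec_mv_nth: "vec_mv v $ I = (if \<exists>i. I = {i} then v $ the_elem I else 0)"
  by (auto simp: vec_mv_def axis_def if_distrib cong: if_cong)

lemma mv_vec_vec_mv [simp]: "mv_vec (vec_mv v) = v"
  by (simp add: vec_eq_iff mv_vec_def vec_mv_nth)

lemma vec_mv_mv_vec:
  assumes "\<omega> \<in> grade 1" shows "vec_mv (mv_vec \<omega>) = \<omega>"
  using assms by (auto simp: vec_eq_iff mv_vec_def vec_mv_nth grade_def card_1_singleton_iff)

lemma wedge_axis:
  "axis I 1 \<and>\<^sub>m axis J 1 = (if I \<inter> J = {} then shuffle_sign I J *\<^sub>R axis (I \<union> J) 1 else 0)"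
proof -
  have "(axis I 1 \<and>\<^sub>m axis J 1) $ K
      = (\<Sum>L\<in>Pow K. if L = I then shuffle_sign I (K - I) * axis J 1 $ (K - I) else 0)" for K
    unfolding wedge_def vec_lambda_beta by (rule sum.cong) (auto simp: axis_def)
  then have "(axis I 1 \<and>\<^sub>m axis J 1) $ K
      = (if I \<subseteq> K \<and> K - I = J then shuffle_sign I J else 0)" for K
    by (simp add: axis_def)
  moreover have "(I \<subseteq> K \<and> K - I = J) = (I \<inter> J = {} \<and> K = I \<union> J)" for K
    by blast
  ultimately have "(axis I 1 \<and>\<^sub>m axis J 1) $ K
      = (if I \<inter> J = {} \<and> K = I \<union> J then shuffle_sign I J else 0)" for K
    by simp
  then show ?thesis
    by (cases "I \<inter> J = {}") (simp_all add: vec_eq_iff axis_def)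
qed

lemma shuffle_sign_square: "shuffle_sign I J * shuffle_sign I J = 1"
  unfolding shuffle_sign_def by (auto simp: prod.distrib[symmetric] intro!: prod.neutral)

text \<open>The defining property of the Hodge star; \<open>axis UNIV 1\<close> is the volume form.\<close>
lemma wedge_hodge:
  assumes "\<omega> \<in> grade k" "\<eta> \<in> grade k"
  shows "\<omega> \<and>\<^sub>m hodge \<eta> = (\<omega> \<bullet> \<eta>) *\<^sub>R axis UNIV 1"
proof -
  have "(\<omega> \<and>\<^sub>m hodge \<eta>) $ K = (\<omega> \<bullet> \<eta>) * axis UNIV 1 $ K" for K
  proof (cases "K = UNIV")
    case True
    have "shuffle_sign I (- I) * \<omega> $ I * (shuffle_sign I (- I) * \<eta> $ I) = \<omega> $ I * \<eta> $ I" for I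
      using shuffle_sign_square[of I "-I"] by (metis (no_types, lifting) mult.assoc mult.left_commute mult_1)
    then have "(\<Sum>I\<in>UNIV. shuffle_sign I (- I) * \<omega> $ I * (shuffle_sign I (- I) * \<eta> $ I))
        = (\<Sum>I\<in>UNIV. \<omega> $ I * \<eta> $ I)"
      by (intro sum.cong refl)
    then show ?thesis using True
      by (simp add: wedge_def hodge_def inner_vec_def axis_def Compl_eq_Diff_UNIV[symmetric])
  next
    case False
    have "\<omega> $ I * \<eta> $ (-(K - I)) = 0" if "I \<subseteq> K" for I
    proof (rule ccontr)
      assume "\<omega> $ I * \<eta> $ (-(K - I)) \<noteq> 0"
      then have "card I = card (-(K - I))" using assms by (auto simp: grade_def)
      moreover have "I \<subset> -(K - I)" using that False by auto
      ultimately show False by (metis finite psubset_card_mono less_irrefl)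
    qed
    then have "shuffle_sign I (K - I) * \<omega> $ I * hodge \<eta> $ (K - I) = 0" if "I \<subseteq> K" for I
      using that by (simp add: hodge_def) blast
    then have "(\<omega> \<and>\<^sub>m hodge \<eta>) $ K = 0"
      unfolding wedge_def vec_lambda_beta by (intro sum.neutral) blast
    then show ?thesis using False by (simp add: axis_def)
  qed
  then show ?thesis by (simp add: vec_eq_iff)
qed

lemma vec_wedge_nth:
  "(vec_mv v \<and>\<^sub>m \<omega>) $ K = (\<Sum>i\<in>K. shuffle_sign {i} (K - {i}) * v $ i * \<omega> $ (K - {i}))"
proof -
  have "(vec_mv v \<and>\<^sub>m \<omega>) $ K
      = (\<Sum>I\<in>(\<lambda>i. {i}) ` K. shuffle_sign I (K - I) * vec_mv v $ I * \<omega> $ (K - I))"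
    unfolding wedge_def vec_lambda_beta
    by (rule sum.mono_neutral_right) (auto simp: vec_mv_nth)
  also have "\<dots> = (\<Sum>i\<in>K. shuffle_sign {i} (K - {i}) * v $ i * \<omega> $ (K - {i}))"
    by (subst sum.reindex) (auto simp: vec_mv_nth)
  finally show ?thesis .
qed

text \<open>Contraction with \<open>v\<close> is the adjoint of left exterior multiplication by \<open>v\<close>.\<close>
lemma contract_adjoint: "contract v \<omega> \<bullet> \<eta> = \<omega> \<bullet> (vec_mv v \<and>\<^sub>m \<eta>)"
proof -
  let ?t = "\<lambda>i K. shuffle_sign {i} K * v $ i * \<omega> $ insert i K * \<eta> $ K"
  have "contract v \<omega> \<bullet> \<eta> = (\<Sum>K\<in>UNIV. \<Sum>i\<in>-K. ?t i K)"
    by (simp add: inner_vec_def contract_def sum_distrib_right)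
  also have "\<dots> = (\<Sum>(K, i)\<in>(SIGMA K:UNIV. -K). ?t i K)"
    by (subst sum.Sigma) auto
  also have "\<dots> = (\<Sum>(K, i)\<in>(SIGMA K:UNIV. K). ?t i (K - {i}))"
    by (rule sum.reindex_bij_witness[where i = "\<lambda>(K, i). (K - {i}, i)" and j = "\<lambda>(K, i). (insert i K, i)"])
       (auto simp: insert_absorb)
  also have "\<dots> = (\<Sum>K\<in>UNIV. \<Sum>i\<in>K. ?t i (K - {i}))"
    by (subst sum.Sigma) auto
  also have "\<dots> = \<omega> \<bullet> (vec_mv v \<and>\<^sub>m \<eta>)"
    by (auto simp: inner_vec_def vec_wedge_nth sum_distrib_left insert_absorb intro!: sum.cong)
  finally show ?thesis .
qed

text \<open>\<open>mv_vec\<close> discards nothing in \<open>c3\<close> and \<open>c4\<close>.\<close>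

lemma grade_vec_wedge:
  assumes "\<omega> \<in> grade k" shows "vec_mv v \<and>\<^sub>m \<omega> \<in> grade (Suc k)"
proof -
  have "card K = Suc k" if nz: "(vec_mv v \<and>\<^sub>m \<omega>) $ K \<noteq> 0" for K
  proof -
    obtain i where "i \<in> K" "\<omega> $ (K - {i}) \<noteq> 0"
      using nz unfolding vec_wedge_nth
      by (metis (no_types, lifting) mult_zero_right sum.neutral)
    then show ?thesis
      using assms card_Suc_Diff1[of K i] by (auto simp: grade_def)
  qed
  then show ?thesis by (simp add: grade_def)
qed

lemma grade_contract:
  assumes "\<omega> \<in> grade (Suc k)" shows "contract v \<omega> \<in> grade k"
proof -
  have "card K = k" if nz: "contract v \<omega> $ K \<noteq> 0" for K
  proof -
    obtain i where "i \<notin> K" "\<omega> $ insert i K \<noteq> 0"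
      using nz unfolding contract_def vec_lambda_beta
      by (metis (no_types, lifting) ComplD mult_zero_right sum.neutral)
    then show ?thesis
      using assms by (fastforce simp: grade_def)
  qed
  then show ?thesis by (simp add: grade_def)
qed

lemma grade_hodge:
  fixes \<omega> :: "('n::{finite,linorder}) multivector"
  assumes "\<omega> \<in> grade k" shows "hodge \<omega> \<in> grade (CARD('n) - k)"
proof -
  have compl: "card K = CARD('n) - card (-K)" for K :: "'n set"
    using card_Un_disjoint[of K "-K"] by simp
  have "card K = CARD('n) - k" if "hodge \<omega> $ K \<noteq> 0" for K
  proof -
    have "card (-K) = k" using assms that by (simp add: grade_def hodge_def)
    then show ?thesis by (subst compl) simp
  qed
  then show ?thesis unfolding grade_def by blast
qed

lemma grade_vec_mv: "vec_mv v \<in> grade 1"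
proof -
  have "card I = 1" if "vec_mv v $ I \<noteq> 0" for I
    using that card_1_singleton_iff by (fastforce simp: vec_mv_nth split: if_split_asm)
  then show ?thesis by (simp add: grade_def)
qed

lemma subspace_grade: "subspace (grade k)"
proof (rule subspaceI)
  fix \<omega> \<eta> :: "'a multivector" assume *: "\<omega> \<in> grade k" "\<eta> \<in> grade k"
  have "card I = k" if "(\<omega> + \<eta>) $ I \<noteq> 0" for I
    using * that by (cases "\<omega> $ I = 0") (simp_all add: grade_def)
  then show "\<omega> + \<eta> \<in> grade k" by (simp add: grade_def)
qed (simp_all add: grade_def)

lemma vec_mv_c3:
  fixes v w :: "real ^ ('n::{finite,linorder})"
  assumes "CARD('n) = 3"
  shows "vec_mv (mv_vec (hodge (vec_mv v \<and>\<^sub>m vec_mv w))) = hodge (vec_mv v \<and>\<^sub>m vec_mv w)"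
  using grade_hodge[OF grade_vec_wedge[OF grade_vec_mv[of w], of v]]
  by (intro vec_mv_mv_vec) (simp add: assms)

lemma vec_mv_c4:
  fixes v :: "real ^ ('n::{finite,linorder})"
  assumes "CARD('n) = 4" "\<tau> \<in> anti_self_dual"
  shows "vec_mv (mv_vec (hodge (vec_mv v \<and>\<^sub>m \<tau>) - contract v \<tau>))
    = hodge (vec_mv v \<and>\<^sub>m \<tau>) - contract v \<tau>"
proof -
  have "\<tau> \<in> grade (Suc 1)" using assms(2) by (simp add: anti_self_dual_def numeral_2_eq_2)
  then have "hodge (vec_mv v \<and>\<^sub>m \<tau>) \<in> grade 1" "contract v \<tau> \<in> grade 1"
    using grade_hodge[OF grade_vec_wedge, of \<tau> "Suc 1" v] grade_contract[of \<tau> 1 v]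
    by (simp_all add: assms)
  then show ?thesis
    by (intro vec_mv_mv_vec subspace_diff[OF subspace_grade])
qed

lemma subspace_anti_self_dual: "subspace (anti_self_dual :: ('n::{finite,linorder}) multivector set)"
proof -
  have "(anti_self_dual :: 'n multivector set) = grade 2 \<inter> {\<tau>. hodge \<tau> = - \<tau>}"
    by (auto simp: anti_self_dual_def)
  moreover have "subspace {\<tau> :: 'n multivector. hodge \<tau> = - \<tau>}"
    by (auto simp: subspace_def hodge_def vec_eq_iff algebra_simps)
  ultimately show ?thesis by (metis subspace_inter subspace_grade)
qed

lemma orth_proj_unique:
  assumes "subspace S" "p \<in> S" "\<And>s. s \<in> S \<Longrightarrow> orthogonal (x - p) s"
  shows "orth_proj S x = p"
  unfolding orth_proj_def
proof (rule the_equality)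
  show "p \<in> S \<and> (\<forall>s\<in>S. orthogonal (x - p) s)" using assms by blast
next
  fix q assume q: "q \<in> S \<and> (\<forall>s\<in>S. orthogonal (x - q) s)"
  have "p - q \<in> S" using assms q by (blast intro: subspace_diff)
  then have "(x - q) \<bullet> (p - q) = 0" "(x - p) \<bullet> (p - q) = 0"
    using assms q by (auto simp: orthogonal_def)
  then have "(p - q) \<bullet> (p - q) = 0" by (simp add: inner_diff_left)
  then show "q = p" by simp
qed

lemma clifford_axis_mult:
  "Clifford (axis I 1) * Clifford (axis J 1)
    = clifford_sign I J *\<^sub>R Clifford (axis (sym_diff I J) 1)"
proof -
  have "(\<Sum>L\<in>UNIV. clifford_sign L (sym_diff L K) * axis I 1 $ L * axis J 1 $ sym_diff L K)
      = clifford_sign I J * axis (sym_diff I J) 1 $ K" for K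
  proof -
    have "(\<Sum>L\<in>UNIV. clifford_sign L (sym_diff L K) * axis I 1 $ L * axis J 1 $ sym_diff L K)
        = (\<Sum>L\<in>UNIV. if L = I then clifford_sign I (sym_diff I K) * axis J 1 $ sym_diff I K else 0)"
      by (rule sum.cong) (auto simp: axis_def)
    also have "\<dots> = clifford_sign I J * axis (sym_diff I J) 1 $ K"
    proof -
      have "sym_diff I K = J \<longleftrightarrow> K = sym_diff I J" by auto
      then show ?thesis by (cases "sym_diff I K = J") (auto simp: axis_def)
    qed
    finally show ?thesis .
  qed
  then show ?thesis
    by (simp add: times_clifford_def scaleR_clifford_def Clifford_inverse vec_eq_iff
        Clifford_inject)
qed

lemma coeffs_sum: "coeffs (sum f A) = (\<Sum>x\<in>A. coeffs (f x))"
  by (induction A rule: infinite_finite_induct) (simp_all add: zero_clifford.rep_eq plus_clifford.rep_eq)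

lemma clifford_expand: "a = (\<Sum>I\<in>UNIV. coeffs a $ I *\<^sub>R Clifford (axis I 1))"
  by (simp add: coeffs_inject[symmetric] coeffs_sum scaleR_clifford.rep_eq Clifford_inverse
      vec_eq_iff axis_def if_distrib cong: if_cong)

lemma vec_clifford_expand: "vec_clifford v = (\<Sum>i\<in>UNIV. v $ i *\<^sub>R Clifford (axis {i} 1))"
  by (simp add: coeffs_inject[symmetric] coeffs_sum scaleR_clifford.rep_eq Clifford_inverse
      vec_clifford_def)

lemma vec_clifford_axis: "vec_clifford (axis i 1) = Clifford (axis {i} 1)"
  by (simp add: vec_clifford_expand axis_def if_distrib if_distribR cong: if_cong)

definition basis_action ::
    "(real ^ ('n::{finite,linorder}) \<Rightarrow> 'a \<Rightarrow> 'a) \<Rightarrow> 'n set \<Rightarrow> 'a \<Rightarrow> 'a" where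
  "basis_action c I = foldr (\<lambda>i. c (axis i 1)) (sorted_list_of_set I)"

lemma basis_action_empty [simp]: "basis_action c {} x = x"
  by (simp add: basis_action_def)

lemma basis_action_insert:
  assumes "\<And>j. j \<in> I \<Longrightarrow> i < j"
  shows "basis_action c (insert i I) x = c (axis i 1) (basis_action c I x)"
proof -
  have "sorted_list_of_set (insert i I) = i # sorted_list_of_set I"
    using assms by (subst sorted_list_of_set_nonempty)
      (auto simp: Min_insert2 less_imp_le intro!: arg_cong[where f = sorted_list_of_set])
  then show ?thesis by (simp add: basis_action_def)
qed

context
  fixes V :: "'a::real_vector set" and c :: "real ^ ('n::{finite,linorder}) \<Rightarrow> 'a \<Rightarrow> 'a"
  assumes c: "clifford_map V c"
begin

lemma V: "subspace V" and c_closed: "x \<in> V \<Longrightarrow> c v x \<in> V"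
  and c_add: "\<lbrakk>x \<in> V; y \<in> V\<rbrakk> \<Longrightarrow> c v (x + y) = c v x + c v y"
  and c_scale: "x \<in> V \<Longrightarrow> c v (r *\<^sub>R x) = r *\<^sub>R c v x"
  and c_linear: "x \<in> V \<Longrightarrow> linear (\<lambda>v. c v x)"
  and c_rel: "x \<in> V \<Longrightarrow> c v (c w x) + c w (c v x) = (- 2 * (v \<bullet> w)) *\<^sub>R x"
  using c unfolding clifford_map_def by blast+

lemma basis_action_closed: "x \<in> V \<Longrightarrow> basis_action c I x \<in> V"
  by (induction I rule: finite_linorder_min_induct[OF finite])
     (simp_all add: basis_action_insert c_closed)

lemma basis_action_add:
  "\<lbrakk>x \<in> V; y \<in> V\<rbrakk> \<Longrightarrow> basis_action c I (x + y) = basis_action c I x + basis_action c I y"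
  by (induction I rule: finite_linorder_min_induct[OF finite])
     (simp_all add: basis_action_insert c_add basis_action_closed)

lemma basis_action_scale: "x \<in> V \<Longrightarrow> basis_action c I (r *\<^sub>R x) = r *\<^sub>R basis_action c I x"
  by (induction I rule: finite_linorder_min_induct[OF finite])
     (simp_all add: basis_action_insert c_scale basis_action_closed)

lemma c_square: "x \<in> V \<Longrightarrow> c (axis i 1) (c (axis i 1) x) = - x"
proof -
  assume "x \<in> V"
  from c_rel[OF this, of "axis i 1" "axis i 1"]
  have "2 *\<^sub>R c (axis i 1) (c (axis i 1) x) = 2 *\<^sub>R (- x)"
    by (simp add: inner_axis_axis scaleR_2)
  then show ?thesis by (simp only: scaleR_cancel_left) simp
qed

lemma c_anticommute:
  "\<lbrakk>x \<in> V; i \<noteq> j\<rbrakk> \<Longrightarrow> c (axis i 1) (c (axis j 1) x) = - c (axis j 1) (c (axis i 1) x)"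
  using c_rel[of x "axis i 1" "axis j 1"] by (simp add: inner_axis_axis eq_neg_iff_add_eq_0)

lemma basis_action_step:
  assumes "x \<in> V"
  shows "c (axis i 1) (basis_action c J x)
    = clifford_sign {i} J *\<^sub>R basis_action c (sym_diff {i} J) x"
  using finite[of J]
proof (induction J rule: finite_linorder_min_induct)
  case empty
  then show ?case using basis_action_insert[of "{}" i c x] by simp
next
  case (insert j J)
  consider "i < j" | "i = j" | "j < i" by fastforce
  then show ?case
  proof cases
    case 1
    then have "\<And>k. k \<in> insert j J \<Longrightarrow> i < k" using insert by (auto intro: less_trans)
    moreover from this have "clifford_sign {i} (insert j J) = 1"
      by (force simp: clifford_sign_def intro!: prod.neutral)
    moreover have "sym_diff {i} (insert j J) = insert i (insert j J)"
      using calculation(1) by auto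
    ultimately show ?thesis
      using basis_action_insert[of "insert j J" i c x] by simp
  next
    case 2
    have "clifford_sign {i} J = 1"
      using 2 insert by (force simp: clifford_sign_def intro!: prod.neutral)
    then have "clifford_sign {i} (insert j J) = -1"
      using 2 insert by (subst clifford_sign_def) (auto simp: clifford_sign_def)
    moreover have "sym_diff {i} (insert j J) = J" using 2 insert by auto
    moreover have "basis_action c (insert j J) x = c (axis j 1) (basis_action c J x)"
      using insert.hyps(2) by (intro basis_action_insert) blast
    ultimately show ?thesis
      using 2 c_square[OF basis_action_closed[OF assms], of j J] by (simp only:) simp
  next
    case 3
    have s: "clifford_sign {i} (insert j J) = - clifford_sign {i} J"
      using 3 insert by (subst clifford_sign_def) (auto simp: clifford_sign_def)
    have d: "sym_diff {i} (insert j J) = insert j (sym_diff {i} J)"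
      using 3 insert by auto
    have "\<And>k. k \<in> sym_diff {i} J \<Longrightarrow> j < k" using 3 insert by auto
    then have e: "basis_action c (insert j (sym_diff {i} J)) x
        = c (axis j 1) (basis_action c (sym_diff {i} J) x)"
      by (rule basis_action_insert)
    have "c (axis i 1) (basis_action c (insert j J) x)
        = - c (axis j 1) (c (axis i 1) (basis_action c J x))"
      using 3 insert.hyps(2) by (subst basis_action_insert)
        (blast, intro c_anticommute basis_action_closed[OF assms], blast)
    also have "\<dots> = - (clifford_sign {i} J *\<^sub>R c (axis j 1) (basis_action c (sym_diff {i} J) x))"
      by (simp only: insert.IH c_scale[OF basis_action_closed[OF assms]])
    finally show ?thesis by (simp only: s d e scaleR_minus_left)
  qed
qed

lemma basis_action_mult:
  assumes "x \<in> V"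
  shows "basis_action c I (basis_action c J x)
    = clifford_sign I J *\<^sub>R basis_action c (sym_diff I J) x"
  using finite[of I]
proof (induction I rule: finite_linorder_min_induct)
  case empty
  then show ?case by simp
next
  case (insert i I)
  have 1: "sym_diff {i} I = insert i I" using insert by auto
  have 2: "clifford_sign {i} I = 1"
    using insert by (force simp: clifford_sign_def intro!: prod.neutral)
  have 3: "sym_diff {i} (sym_diff I J) = sym_diff (insert i I) J" using insert by auto
  have 4: "clifford_sign (insert i I) J = clifford_sign I J * clifford_sign {i} (sym_diff I J)"
    by (simp only: 1[symmetric] clifford_sign_sym_diff_left clifford_sign_sym_diff_right 2) simp
  have "basis_action c (insert i I) (basis_action c J x)
      = clifford_sign I J *\<^sub>R c (axis i 1) (basis_action c (sym_diff I J) x)"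
    using insert
    by (simp only: basis_action_insert insert.IH c_scale[OF basis_action_closed[OF assms]])
  then show ?case
    by (simp only: basis_action_step[OF assms] 3 4 scaleR_scaleR)
qed

text \<open>Every \<open>c\<close> satisfying the Clifford relations extends uniquely to a module structure.\<close>
lemma extends_to_module_exists: "\<exists>\<rho>. extends_to_module V c \<rho>"
proof -
  define \<rho> where "\<rho> a x = (\<Sum>I\<in>UNIV. coeffs a $ I *\<^sub>R basis_action c I x)" for a x
  have closed: "\<rho> a x \<in> V" if "x \<in> V" for a x
    unfolding \<rho>_def using that
    by (intro subspace_sum[OF V] subspace_scale[OF V] basis_action_closed)
  have sum_action: "basis_action c I (\<Sum>J\<in>A. f J *\<^sub>R basis_action c J x)
      = (\<Sum>J\<in>A. f J *\<^sub>R basis_action c I (basis_action c J x))"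
    if "x \<in> V" "finite A" for I x f and A :: "'n set set"
    using that(2)
  proof (induction A rule: finite_induct)
    case empty
    then show ?case using basis_action_scale[OF that(1), of I 0] by simp
  next
    case (insert J A)
    have "(\<Sum>J\<in>A. f J *\<^sub>R basis_action c J x) \<in> V"
      using that(1) by (intro subspace_sum[OF V] subspace_scale[OF V] basis_action_closed)
    then show ?case using insert that(1)
      by (simp add: basis_action_add basis_action_scale basis_action_closed subspace_scale[OF V])
  qed
  have mult: "\<rho> (a * b) x = \<rho> a (\<rho> b x)" if x: "x \<in> V" for a b x
  proof -
    define t where "t I J = (coeffs a $ I * coeffs b $ J * clifford_sign I J)
      *\<^sub>R basis_action c (sym_diff I J) x" for I J
    have "\<rho> (a * b) x = (\<Sum>K\<in>UNIV. \<Sum>I\<in>UNIV. t I (sym_diff I K))"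
    proof -
      have "sym_diff I (sym_diff I K) = K" for I K :: "'n set" by auto
      then show ?thesis
        unfolding \<rho>_def times_clifford.rep_eq t_def by (simp add: scaleR_sum_left mult_ac)
    qed
    also have "\<dots> = (\<Sum>I\<in>UNIV. \<Sum>K\<in>UNIV. t I (sym_diff I K))"
      by (rule sum.swap)
    also have "\<dots> = (\<Sum>I\<in>UNIV. \<Sum>J\<in>UNIV. t I J)"
      by (intro sum.cong refl sum.reindex_bij_betw bij_sym_diff)
    also have "\<dots> = \<rho> a (\<rho> b x)"
      unfolding \<rho>_def t_def
      by (simp add: sum_action[OF x] basis_action_mult[OF x] scaleR_sum_right mult.assoc)
    finally show ?thesis .
  qed
  have vec: "\<rho> (vec_clifford v) x = c v x" if x: "x \<in> V" for v x
  proof -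
    have "\<rho> (vec_clifford v) x
        = (\<Sum>I\<in>(\<lambda>i. {i}) ` UNIV. coeffs (vec_clifford v) $ I *\<^sub>R basis_action c I x)"
      unfolding \<rho>_def
      by (rule sum.mono_neutral_right)
         (auto simp: vec_clifford_def Clifford_inverse axis_def image_iff intro!: sum.neutral)
    also have "\<dots> = (\<Sum>i\<in>UNIV. v $ i *\<^sub>R c (axis i 1) x)"
      using basis_action_insert[of "{}" _ c x]
      by (subst sum.reindex)
         (auto simp: vec_clifford_def Clifford_inverse axis_def if_distrib cong: if_cong intro!: sum.cong)
    also have "\<dots> = c (\<Sum>i\<in>UNIV. v $ i *\<^sub>R axis i 1) x"
      by (simp only: linear_sum[OF c_linear[OF x]] linear_scale[OF c_linear[OF x]])
    also have "(\<Sum>i\<in>UNIV. v $ i *\<^sub>R axis i 1) = v"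
      by (simp add: vec_eq_iff axis_def if_distrib cong: if_cong)
    finally show ?thesis .
  qed
  have one: "\<rho> 1 x = x" for x
  proof -
    have "\<rho> 1 x = (\<Sum>I\<in>(UNIV :: 'n set set). if I = {} then x else 0)"
      unfolding \<rho>_def one_clifford.rep_eq by (rule sum.cong) (auto simp: axis_def)
    then show ?thesis by simp
  qed
  have "clifford_module V \<rho>"
    unfolding clifford_module_def
    by (intro conjI allI ballI V closed mult one)
       (simp_all add: \<rho>_def plus_clifford.rep_eq scaleR_clifford.rep_eq basis_action_add
         basis_action_scale scaleR_add_right scaleR_add_left sum.distrib scaleR_sum_right
         mult.commute)
  then show ?thesis
    unfolding extends_to_module_def using vec by blast
qed

lemma extends_to_module_eq:
  assumes \<rho>: "extends_to_module V c \<rho>" and x: "x \<in> V"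
  shows "\<rho> a x = (\<Sum>I\<in>UNIV. coeffs a $ I *\<^sub>R basis_action c I x)"
proof -
  from \<rho> have m: "\<And>a b x. x \<in> V \<Longrightarrow> \<rho> (a * b) x = \<rho> a (\<rho> b x)"
    and add: "\<And>a b x. x \<in> V \<Longrightarrow> \<rho> (a + b) x = \<rho> a x + \<rho> b x"
    and scale: "\<And>a r x. x \<in> V \<Longrightarrow> \<rho> (r *\<^sub>R a) x = r *\<^sub>R \<rho> a x"
    and one: "\<And>x. x \<in> V \<Longrightarrow> \<rho> 1 x = x"
    and vec: "\<And>v x. x \<in> V \<Longrightarrow> \<rho> (vec_clifford v) x = c v x"
    by (auto simp: extends_to_module_def clifford_module_def)
  have basis: "\<rho> (Clifford (axis I 1)) x = basis_action c I x" for I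
    using finite[of I]
  proof (induction I rule: finite_linorder_min_induct)
    case empty
    then show ?case using one[OF x] by (simp add: one_clifford_def)
  next
    case (insert i I)
    have 1: "sym_diff {i} I = insert i I" using insert by auto
    have 2: "clifford_sign {i} I = 1"
      using insert by (force simp: clifford_sign_def intro!: prod.neutral)
    have "Clifford (axis (insert i I) 1) = vec_clifford (axis i 1) * Clifford (axis I 1)"
      by (simp only: vec_clifford_axis clifford_axis_mult 1 2) simp
    then show ?case
      using insert x by (simp add: m insert.IH vec basis_action_closed basis_action_insert)
  qed
  have lin: "linear (\<lambda>a. \<rho> a x)"
    by (rule linearI) (simp_all add: add scale x)
  have "\<rho> a x = \<rho> (\<Sum>I\<in>UNIV. coeffs a $ I *\<^sub>R Clifford (axis I 1)) x"
    by (simp only: clifford_expand[symmetric])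
  also have "\<dots> = (\<Sum>I\<in>UNIV. coeffs a $ I *\<^sub>R basis_action c I x)"
    by (simp only: linear_sum[OF lin] linear_scale[OF lin] basis)
  finally show ?thesis .
qed

lemma extends_to_module_unique:
  assumes "extends_to_module V c \<rho>" "extends_to_module V c \<rho>'" "x \<in> V"
  shows "\<rho> a x = \<rho>' a x"
  using assms by (simp add: extends_to_module_eq)

end

lemma vec_clifford_relation:
  "vec_clifford v * vec_clifford w + vec_clifford w * vec_clifford v = (- 2 * (v \<bullet> w)) *\<^sub>R 1"
proof -
  let ?e = "\<lambda>i. Clifford (axis {i} 1)"
  have e: "?e i * ?e j + ?e j * ?e i = (if i = j then -2 else 0) *\<^sub>R 1" for i j
  proof (cases "i = j")
    case True
    then show ?thesis
      by (simp add: clifford_axis_mult clifford_sign_def one_clifford_def scaleR_2[symmetric])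
  next
    case False
    have "sym_diff {i} {j} = {i, j}" "sym_diff {j} {i} = {i, j}" using False by auto
    then show ?thesis using False
      by (cases "i < j") (auto simp: clifford_axis_mult clifford_sign_def)
  qed
  have "vec_clifford v * vec_clifford w + vec_clifford w * vec_clifford v
      = (\<Sum>i\<in>UNIV. \<Sum>j\<in>UNIV. (v $ i * w $ j) *\<^sub>R (?e i * ?e j + ?e j * ?e i))"
    unfolding vec_clifford_expand
    by (subst (2) sum_product, subst sum.swap)
       (simp add: sum_product sum.distrib[symmetric] scaleR_add_right mult.commute)
  also have "\<dots> = (\<Sum>i\<in>UNIV. \<Sum>j\<in>UNIV. if i = j then (v $ i * w $ j * -2) *\<^sub>R 1 else 0)"
    unfolding e by (intro sum.cong refl) simp
  also have "\<dots> = (\<Sum>i\<in>UNIV. (v $ i * w $ i * -2) *\<^sub>R 1)"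
    by simp
  also have "\<dots> = (- 2 * (v \<bullet> w)) *\<^sub>R 1"
    by (simp only: scaleR_sum_left[symmetric] sum_distrib_right[symmetric] inner_vec_def
        inner_real_def mult.commute[of "-2"])
  finally show ?thesis .
qed

end

theory Submission
  imports Defs
begin

text \<open>All three families are handled by the same two arguments.

  \<^bold>\<open>Clifford relations.\<close> By polarisation it is enough that \<open>c v (c v x) = - (v \<bullet> v) x\<close>
  (\<open>clifford_mapI\<close>). Exterior multiplication by \<open>v\<close> and contraction with \<open>v\<close> both square to zero,
  and their anticommutator is \<open>v \<bullet> v\<close> (\<open>contract_wedge\<close>); this gives \<open>c12\<close> at once, in every
  dimension. The other two maps are reduced to the same identities by
  \<open>\<star>(v \<and> \<star>\<omega>) = \<plusminus> \<iota>\<^sub>v \<omega>\<close> (\<open>hodge_wedge_hodge\<close>) and \<open>\<star>\<star> = \<plusminus> 1\<close>. For \<open>n = 3\<close> this yields the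
  triple product formula for the cross product \<open>\<star>(v \<and> w)\<close>. For \<open>n = 4\<close> it turns
  \<open>\<star>(v \<and> \<tau>) - \<iota>\<^sub>v \<tau>\<close> into \<open>- 2 \<iota>\<^sub>v \<tau>\<close> for anti-self-dual \<open>\<tau>\<close>, and the projection of \<open>\<omega>\<close> is
  \<open>(\<omega> - \<star>\<omega>) / 2\<close>.

  \<^bold>\<open>Irreducibility.\<close> Let \<open>\<Omega>\<close> be the element \<open>1\<close> of \<open>\<and>\<^sup>0\<close>. In each of the modules an element is
  \<open>x = c w \<Omega> + t\<close>, where \<open>c v t\<close> has the form \<open>c u \<Omega>\<close> for every \<open>v\<close>. Indeed the elements of
  degree one are exactly the \<open>c u \<Omega>\<close>, and \<open>c v\<close> sends the even part into degree one. If \<open>w \<noteq> 0\<close>, then \<open>c w x\<close> is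
  \<open>b \<Omega> + c u \<Omega>\<close> with \<open>b = - (w \<bullet> w) \<noteq> 0\<close>, and since \<open>c u\<close> squares to \<open>- (u \<bullet> u)\<close>,
  the conjugate \<open>b - c u\<close> maps it to \<open>(b\<^sup>2 + u \<bullet> u) \<Omega>\<close>. If \<open>w = 0\<close>, then \<open>c e x = c u \<Omega>\<close> for a unit
  vector \<open>e\<close>, and \<open>c u\<close> maps this to \<open>- (u \<bullet> u) \<Omega>\<close>. So every nonzero submodule contains \<open>\<Omega>\<close>. Moreover
  \<open>t = - c e (c e t) = - c e (c u \<Omega>)\<close>, so that \<open>\<Omega>\<close> generates the module
  (\<open>makes_irreducible_moduleI\<close>).\<close>


section \<open>Shuffle signs\<close>

lemma shuffle_sign_empty [simp]: "shuffle_sign {} J = 1" "shuffle_sign I {} = 1"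
  by (simp_all add: shuffle_sign_def)

lemma shuffle_sign_insert_left:
  "i \<notin> I \<Longrightarrow> shuffle_sign (insert i I) J = shuffle_sign {i} J * shuffle_sign I J"
  by (simp add: shuffle_sign_def)

lemma shuffle_sign_insert_right:
  "j \<notin> J \<Longrightarrow> shuffle_sign I (insert j J) = shuffle_sign I {j} * shuffle_sign I J"
  by (simp add: shuffle_sign_def prod.distrib)

lemma shuffle_sign_singletons: "shuffle_sign {i} {j} = (if j < i then -1 else 1)"
  by (simp add: shuffle_sign_def)

lemma shuffle_sign_swap:
  assumes "I \<inter> J = {}"
  shows "shuffle_sign I J * shuffle_sign J I = (-1) ^ (card I * card J)"
proof -
  have "shuffle_sign I J * shuffle_sign J I
      = (\<Prod>i\<in>I. \<Prod>j\<in>J. (if j < i then -1 else 1) * (if i < j then -1 else 1))"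
    unfolding shuffle_sign_def by (subst prod.swap[where A = J and B = I]) (simp add: prod.distrib)
  also have "\<dots> = (\<Prod>i\<in>I. \<Prod>j\<in>J. -1)"
    using assms by (intro prod.cong refl) (auto simp: not_less_iff_gr_or_eq)
  finally show ?thesis by (simp add: power_mult[symmetric] mult.commute)
qed

text \<open>Inserting \<open>i\<close> and \<open>j\<close> in the two possible orders gives opposite signs. The factors \<open>a\<close>, \<open>b\<close>,
  \<open>c\<close> stand for the coordinates and coefficients in a double sum; the first form is the
  antisymmetry of \<open>v \<and> v \<and> \<omega>\<close>, the second the cancellation between \<open>\<iota>\<^sub>v (v \<and> \<omega>)\<close> and
  \<open>v \<and> \<iota>\<^sub>v \<omega>\<close>.\<close>
lemma shuffle_sign_exchange_wedge_wedge:
  assumes "i \<notin> M" "j \<notin> M" "i \<noteq> j"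
  shows "shuffle_sign {j} (insert i M) * a * (shuffle_sign {i} M * b * c)
    = - (shuffle_sign {i} (insert j M) * b * (shuffle_sign {j} M * a * c))"
  using assms(3)
  by (auto simp: shuffle_sign_insert_right[OF assms(1)] shuffle_sign_insert_right[OF assms(2)]
      shuffle_sign_singletons)

lemma shuffle_sign_exchange_wedge_contract:
  assumes "i \<notin> M" "j \<notin> M" "i \<noteq> j"
  shows "shuffle_sign {j} M * a * (shuffle_sign {i} M * b * c)
    = - (shuffle_sign {i} (insert j M) * b * (shuffle_sign {j} (insert i M) * a * c))"
  using assms(3)
  by (auto simp: shuffle_sign_insert_right[OF assms(1)] shuffle_sign_insert_right[OF assms(2)]
      shuffle_sign_singletons)

lemma shuffle_sign_cancel: "shuffle_sign I J * a * (shuffle_sign I J * b) = a * b"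
  using shuffle_sign_square[of I J] by algebra

lemma shuffle_sign_cancel_triple: "shuffle_sign I J * a * (shuffle_sign I J * b * c) = a * b * c"
  using shuffle_sign_square[of I J] by algebra


section \<open>Exterior multiplication, contraction and the Hodge star\<close>

lemma vec_wedge_vec_wedge: "vec_mv v \<and>\<^sub>m (vec_mv v \<and>\<^sub>m \<omega>) = 0"
proof -
  have "(vec_mv v \<and>\<^sub>m (vec_mv v \<and>\<^sub>m \<omega>)) $ K = 0" for K
  proof -
    define t where "t i j = (if i = j then 0 else
      shuffle_sign {i} (K - {i}) * v $ i * (shuffle_sign {j} (K - {i} - {j}) * v $ j
        * \<omega> $ (K - {i} - {j})))" for i j
    have anti: "t j i = - t i j" if "i \<in> K" "j \<in> K" for i j
    proof (cases "i = j")
      case False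
      define M where "M = K - {i} - {j}"
      have *: "K - {i} = insert j M" "K - {j} = insert i M" "K - {j} - {i} = M"
        "i \<notin> M" "j \<notin> M" using that False by (auto simp: M_def)
      then show ?thesis
        using shuffle_sign_exchange_wedge_wedge[of i M j "v $ j" "v $ i" "\<omega> $ M"] False
        unfolding t_def M_def[symmetric] *(1-3)
        by simp
    qed (simp add: t_def)
    have "(vec_mv v \<and>\<^sub>m (vec_mv v \<and>\<^sub>m \<omega>)) $ K = (\<Sum>i\<in>K. \<Sum>j\<in>K. t i j)"
      unfolding vec_wedge_nth sum_distrib_left
    proof (rule sum.cong[OF refl])
      fix i assume "i \<in> K"
      then show "(\<Sum>j\<in>K - {i}. shuffle_sign {i} (K - {i}) * v $ i *
          (shuffle_sign {j} (K - {i} - {j}) * v $ j * \<omega> $ (K - {i} - {j}))) = (\<Sum>j\<in>K. t i j)"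
        by (intro sum.mono_neutral_cong_left) (auto simp: t_def)
    qed
    moreover have "(\<Sum>i\<in>K. \<Sum>j\<in>K. t i j) = - (\<Sum>i\<in>K. \<Sum>j\<in>K. t i j)"
    proof -
      have "(\<Sum>i\<in>K. \<Sum>j\<in>K. t i j) = (\<Sum>j\<in>K. \<Sum>i\<in>K. t i j)"
        by (rule sum.swap)
      also have "\<dots> = (\<Sum>j\<in>K. \<Sum>i\<in>K. - t j i)"
        by (intro sum.cong refl anti)
      finally show ?thesis by (simp add: sum_negf)
    qed
    ultimately show ?thesis by simp
  qed
  then show ?thesis by (simp add: vec_eq_iff)
qed

lemma contract_wedge:
  "contract v (vec_mv v \<and>\<^sub>m \<omega>) + vec_mv v \<and>\<^sub>m contract v \<omega> = (v \<bullet> v) *\<^sub>R \<omega>"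
proof -
  have "contract v (vec_mv v \<and>\<^sub>m \<omega>) $ K + (vec_mv v \<and>\<^sub>m contract v \<omega>) $ K = (v \<bullet> v) * \<omega> $ K" for K
  proof -
    \<comment> \<open>The diagonal terms of the two double sums run over \<open>i \<notin> K\<close> and over \<open>j \<in> K\<close>, and together make
      up \<open>v \<bullet> v\<close>; the terms with \<open>i \<notin> K\<close>, \<open>j \<in> K\<close> occur in both sums with opposite signs.\<close>
    let ?t = "\<lambda>i j. shuffle_sign {i} K * v $ i *
      (shuffle_sign {j} (insert i K - {j}) * v $ j * \<omega> $ (insert i K - {j}))"
    let ?u = "\<lambda>j i. shuffle_sign {j} (K - {j}) * v $ j *
      (shuffle_sign {i} (K - {j}) * v $ i * \<omega> $ insert i (K - {j}))"
    have u: "?u j i = - ?t i j" if "j \<in> K" "i \<in> -K" for i j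
    proof -
      define M where "M = K - {j}"
      have *: "K = insert j M" "insert i K - {j} = insert i M" "i \<notin> M" "j \<notin> M" "i \<noteq> j"
        using that by (auto simp: M_def)
      show ?thesis
        using shuffle_sign_exchange_wedge_contract[OF *(3-5), of "v $ j" "v $ i" "\<omega> $ insert i M"]
        unfolding M_def[symmetric] *(2) *(1)[symmetric] .
    qed
    have "contract v (vec_mv v \<and>\<^sub>m \<omega>) $ K = (\<Sum>i\<in>-K. \<Sum>j\<in>insert i K. ?t i j)"
      unfolding contract_def vec_wedge_nth vec_lambda_beta sum_distrib_left ..
    also have "\<dots> = (\<Sum>i\<in>-K. v $ i * v $ i * \<omega> $ K + (\<Sum>j\<in>K. ?t i j))"
    proof (rule sum.cong[OF refl])
      fix i assume "i \<in> -K"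
      then have "i \<notin> K" "insert i K - {i} = K" by auto
      then show "(\<Sum>j\<in>insert i K. ?t i j) = v $ i * v $ i * \<omega> $ K + (\<Sum>j\<in>K. ?t i j)"
        by (simp only: sum.insert[OF finite] shuffle_sign_cancel_triple not_False_eq_True)
    qed
    finally have 1: "contract v (vec_mv v \<and>\<^sub>m \<omega>) $ K
      = (\<Sum>i\<in>-K. v $ i * v $ i * \<omega> $ K) + (\<Sum>i\<in>-K. \<Sum>j\<in>K. ?t i j)" by (simp only: sum.distrib)
    have compl: "- (K - {j}) = insert j (-K)" for j by auto
    have "(vec_mv v \<and>\<^sub>m contract v \<omega>) $ K = (\<Sum>j\<in>K. \<Sum>i\<in>insert j (-K). ?u j i)"
      unfolding contract_def vec_wedge_nth vec_lambda_beta sum_distrib_left compl ..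
    also have "\<dots> = (\<Sum>j\<in>K. v $ j * v $ j * \<omega> $ K + (\<Sum>i\<in>-K. ?u j i))"
    proof (rule sum.cong[OF refl])
      fix j assume "j \<in> K"
      then have "j \<notin> - K" "insert j (K - {j}) = K" by auto
      then show "(\<Sum>i\<in>insert j (-K). ?u j i) = v $ j * v $ j * \<omega> $ K + (\<Sum>i\<in>-K. ?u j i)"
        by (simp only: sum.insert[OF finite] shuffle_sign_cancel_triple not_False_eq_True)
    qed
    also have "\<dots> = (\<Sum>j\<in>K. v $ j * v $ j * \<omega> $ K) + (\<Sum>j\<in>K. \<Sum>i\<in>-K. ?u j i)"
      by (rule sum.distrib)
    also have "(\<Sum>j\<in>K. \<Sum>i\<in>-K. ?u j i) = (\<Sum>j\<in>K. \<Sum>i\<in>-K. - ?t i j)"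
      by (intro sum.cong refl u)
    also have "\<dots> = (\<Sum>i\<in>-K. \<Sum>j\<in>K. - ?t i j)"
      by (rule sum.swap)
    also have "\<dots> = - (\<Sum>i\<in>-K. \<Sum>j\<in>K. ?t i j)"
      by (simp only: sum_negf)
    finally have 2: "(vec_mv v \<and>\<^sub>m contract v \<omega>) $ K
      = (\<Sum>j\<in>K. v $ j * v $ j * \<omega> $ K) - (\<Sum>i\<in>-K. \<Sum>j\<in>K. ?t i j)"
      by (simp only: diff_conv_add_uminus)
    have "(\<Sum>i\<in>-K. v $ i * v $ i * \<omega> $ K) + (\<Sum>j\<in>K. v $ j * v $ j * \<omega> $ K)
        = (\<Sum>i\<in>UNIV. v $ i * v $ i * \<omega> $ K)"
      by (subst sum.union_disjoint[symmetric]) auto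
    also have "\<dots> = (v \<bullet> v) * \<omega> $ K"
      by (simp add: inner_vec_def sum_distrib_right)
    finally show ?thesis
      unfolding 1 2 by linarith
  qed
  then show ?thesis by (simp add: vec_eq_iff)
qed

text \<open>Adjoint to the vanishing of \<open>v \<and> v \<and> \<omega>\<close>, because the inner product is positive definite.\<close>
lemma contract_contract: "contract v (contract v \<omega>) = 0"
proof -
  have "contract v (contract v \<omega>) \<bullet> contract v (contract v \<omega>) = 0"
    by (simp only: contract_adjoint[of v "contract v \<omega>"] contract_adjoint[of v \<omega>]
      vec_wedge_vec_wedge inner_zero_right)
  then show ?thesis by simp
qed

lemma card_compl: "card (- K) = CARD('a) - card K" for K :: "'a::finite set"
  by (simp only: Compl_eq_Diff_UNIV card_Diff_subset[OF finite subset_UNIV])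

lemma hodge_hodge:
  fixes \<omega> :: "('n::{finite,linorder}) multivector"
  assumes "\<omega> \<in> grade k"
  shows "hodge (hodge \<omega>) = (-1) ^ (k * (CARD('n) - k)) *\<^sub>R \<omega>"
proof -
  have "hodge (hodge \<omega>) $ K = (-1) ^ (k * (CARD('n) - k)) * \<omega> $ K" for K
  proof (cases "\<omega> $ K = 0")
    case False
    then have "card K = k" using assms by (auto simp: grade_def)
    then have "shuffle_sign (-K) K * shuffle_sign K (-K) = (-1) ^ (k * (CARD('n) - k))"
      using shuffle_sign_swap[of "-K" K] by (simp only: card_compl Compl_disjoint2 mult.commute)
    then show ?thesis
      by (simp only: hodge_def vec_lambda_beta double_complement mult.assoc[symmetric])
  qed (simp add: hodge_def)
  then show ?thesis by (simp add: vec_eq_iff)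
qed

text \<open>Up to sign the Hodge star conjugates exterior multiplication by \<open>v\<close> to contraction with \<open>v\<close>. This
  is the bridge from the formulas for \<open>n = 3\<close> and \<open>n = 4\<close> to \<open>contract_wedge\<close>. For \<open>k = 0\<close> both
  sides vanish, so the truncated \<open>k - 1\<close> does no harm.\<close>
lemma hodge_wedge_hodge:
  fixes \<omega> :: "('n::{finite,linorder}) multivector"
  assumes "\<omega> \<in> grade k"
  shows "hodge (vec_mv v \<and>\<^sub>m hodge \<omega>) = (-1) ^ ((k - 1) * (CARD('n) - k)) *\<^sub>R contract v \<omega>"
proof -
  have "hodge (vec_mv v \<and>\<^sub>m hodge \<omega>) $ K = (-1) ^ ((k - 1) * (CARD('n) - k)) * contract v \<omega> $ K" for K
    unfolding hodge_def contract_def vec_wedge_nth vec_lambda_beta sum_distrib_left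
  proof (rule sum.cong[OF refl])
    fix i assume i: "i \<in> -K"
    define M where "M = -K - {i}"
    have M: "-K = insert i M" "- M = insert i K" "i \<notin> M" "M \<inter> K = {}"
      using i by (auto simp: M_def)
    show "shuffle_sign (-K) K * (shuffle_sign {i} (-K - {i}) * v $ i
        * (shuffle_sign (- (-K - {i})) (-K - {i}) * \<omega> $ (- (-K - {i}))))
      = (-1) ^ ((k - 1) * (CARD('n) - k)) * (shuffle_sign {i} K * v $ i * \<omega> $ insert i K)"
    proof (cases "\<omega> $ insert i K = 0")
      case True
      then show ?thesis unfolding M_def[symmetric] M(2) by simp
    next
      case False
      then have "card (insert i K) = k" using assms by (auto simp: grade_def)
      then have c: "card K = k - 1" "card M = CARD('n) - k" using i
        by (auto simp: M_def card_compl card_Diff_singleton)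
      define p :: real where "p = (-1) ^ ((k - 1) * (CARD('n) - k))"
      have "i \<notin> K" using i by simp
      have p: "shuffle_sign M K * shuffle_sign K M = p"
        using shuffle_sign_swap[OF M(4)] by (simp only: c p_def mult.commute)
      have rearrange: "r * a * (s * x * (s * b * y)) = (s * s) * ((a * b) * (r * x * y))"
        for r a s x b y :: real by simp
      show ?thesis
        unfolding M_def[symmetric] M(2) p_def[symmetric]
        unfolding M(1) shuffle_sign_insert_left[OF M(3)]
          shuffle_sign_insert_left[OF \<open>i \<notin> K\<close>]
        by (rule trans[OF rearrange]) (simp only: p shuffle_sign_square mult_1_left)
    qed
  qed
  then show ?thesis by (simp add: vec_eq_iff)
qed

lemma inner_hodge_hodge: "hodge \<omega> \<bullet> hodge \<eta> = \<omega> \<bullet> \<eta>"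
proof -
  have "hodge \<omega> \<bullet> hodge \<eta> = (\<Sum>K\<in>UNIV. \<omega> $ (-K) * \<eta> $ (-K))"
    unfolding inner_vec_def hodge_def
    by (intro sum.cong refl) (simp add: shuffle_sign_cancel)
  also have "\<dots> = \<omega> \<bullet> \<eta>"
    unfolding inner_vec_def inner_real_def
    by (rule sum.reindex_bij_witness[where i = uminus and j = uminus]) auto
  finally show ?thesis .
qed

lemma contract_vec_mv: "contract v (vec_mv w) = (v \<bullet> w) *\<^sub>R axis {} 1"
proof -
  have "contract v (vec_mv w) $ K = (v \<bullet> w) * axis {} 1 $ K" for K
  proof (cases "K = {}")
    case True
    then show ?thesis by (simp add: contract_def vec_mv_nth axis_def inner_vec_def)
  next
    case False
    then have "vec_mv w $ insert i K = 0" if "i \<in> - K" for i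
      using that by (auto simp: vec_mv_nth)
    then show ?thesis using False by (simp add: contract_def axis_def)
  qed
  then show ?thesis by (simp add: vec_eq_iff)
qed

lemma vec_wedge_one: "vec_mv v \<and>\<^sub>m axis {} 1 = vec_mv v"
proof -
  have "(vec_mv v \<and>\<^sub>m axis {} 1) $ K = vec_mv v $ K" for K
  proof -
    have "(vec_mv v \<and>\<^sub>m axis {} 1) $ K
        = (\<Sum>i\<in>K. shuffle_sign {i} (K - {i}) * v $ i * (if K - {i} = {} then 1 else 0))"
      by (simp only: vec_wedge_nth axis_def vec_lambda_beta)
    also have "\<dots> = vec_mv v $ K"
    proof (cases "\<exists>i. K = {i}")
      case True
      then show ?thesis by (auto simp: vec_mv_nth)
    next
      case False
      then have "K - {i} \<noteq> {}" if "i \<in> K" for i using that by blast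
      then show ?thesis using False by (simp add: vec_mv_nth)
    qed
    finally show ?thesis .
  qed
  then show ?thesis by (simp add: vec_eq_iff)
qed

lemma bilinear_vec_wedge: "bilinear (\<lambda>v \<omega>. vec_mv v \<and>\<^sub>m \<omega>)"
  unfolding bilinear_def
  by (intro conjI allI linearI)
     (simp_all add: vec_eq_iff vec_wedge_nth algebra_simps sum.distrib sum_distrib_left)

lemma bilinear_contract: "bilinear contract"
  unfolding bilinear_def
  by (intro conjI allI linearI)
     (simp_all add: vec_eq_iff contract_def algebra_simps sum.distrib sum_distrib_left)

lemma linear_hodge: "linear hodge"
  by (rule linearI) (simp_all add: vec_eq_iff hodge_def algebra_simps)

lemma linear_mv_vec: "linear mv_vec"
  by (rule linearI) (simp_all add: vec_eq_iff mv_vec_def)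

lemma linear_vec_mv: "linear vec_mv"
  by (rule linearI) (simp_all add: vec_eq_iff vec_mv_nth)

lemma inner_vec_mv: "vec_mv v \<bullet> vec_mv w = v \<bullet> w"
proof -
  have "contract v (vec_mv w) \<bullet> axis {} 1 = vec_mv w \<bullet> vec_mv v"
    by (simp only: contract_adjoint vec_wedge_one)
  then show ?thesis
    by (simp add: contract_vec_mv inner_axis_axis inner_commute)
qed

lemma vec_wedge_self: "vec_mv v \<and>\<^sub>m vec_mv v = 0"
  using vec_wedge_vec_wedge[of v "axis {} 1"] by (simp only: vec_wedge_one)

text \<open>For a unit vector \<open>v\<close> the value is the component of \<open>w\<close> orthogonal to \<open>v\<close>.\<close>
lemma contract_vec_wedge_vec:
  "contract v (vec_mv v \<and>\<^sub>m vec_mv w) = (v \<bullet> v) *\<^sub>R vec_mv w - (v \<bullet> w) *\<^sub>R vec_mv v"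
  using contract_wedge[of v "vec_mv w"]
  by (simp add: contract_vec_mv bilinear_rmul[OF bilinear_vec_wedge] vec_wedge_one eq_diff_eq)


section \<open>Criteria for Clifford maps and irreducible modules\<close>

lemma clifford_mapI:
  assumes V: "subspace V"
    and closed: "\<And>v x. x \<in> V \<Longrightarrow> c v x \<in> V"
    and add: "\<And>v x y. \<lbrakk>x \<in> V; y \<in> V\<rbrakk> \<Longrightarrow> c v (x + y) = c v x + c v y"
    and scale: "\<And>v r x. x \<in> V \<Longrightarrow> c v (r *\<^sub>R x) = r *\<^sub>R c v x"
    and lin: "\<And>x. x \<in> V \<Longrightarrow> linear (\<lambda>v. c v x)"
    and square: "\<And>v x. x \<in> V \<Longrightarrow> c v (c v x) = - ((v \<bullet> v) *\<^sub>R x)"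
  shows "clifford_map V c"
proof -
  have "c v (c w x) + c w (c v x) = (- 2 * (v \<bullet> w)) *\<^sub>R x" if x: "x \<in> V" for v w x
  proof -
    have "c (v + w) (c (v + w) x)
        = c v (c v x) + (c v (c w x) + c w (c v x)) + c w (c w x)"
      using x by (simp add: linear_add[OF lin] add closed subspace_add[OF V])
    then have "c v (c w x) + c w (c v x)
        = - (((v + w) \<bullet> (v + w)) *\<^sub>R x) + (v \<bullet> v) *\<^sub>R x + (w \<bullet> w) *\<^sub>R x"
      by (simp add: square x algebra_simps)
    also have "\<dots> = (- 2 * (v \<bullet> w)) *\<^sub>R x"
      by (simp add: inner_simps inner_commute algebra_simps scaleR_2)
    finally show ?thesis .
  qed
  then show ?thesis
    using assms unfolding clifford_map_def by blast
qed

text \<open>The assumption \<open>dec\<close> says that modulo \<open>{c w \<Omega> | w. True}\<close> every element is represented by some \<open>t\<close>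
  that all the \<open>c v\<close> map back into \<open>{c u \<Omega> | u. True}\<close>. This is the case in a \<open>\<int>/2\<close>-graded module
  with \<open>\<Omega>\<close> even whose odd part is \<open>{c u \<Omega> | u. True}\<close>, with \<open>t\<close> the even part of \<open>x\<close>.\<close>
lemma makes_irreducible_moduleI:
  assumes c: "clifford_map V c" and \<Omega>: "\<Omega> \<in> V" "\<Omega> \<noteq> 0"
    and dec: "\<And>x. x \<in> V \<Longrightarrow> \<exists>w. \<forall>v. \<exists>u. c v (x - c w \<Omega>) = c u \<Omega>"
  shows "makes_irreducible_module V c"
proof -
  note V = V[OF c] and closed = c_closed[OF c] and add = c_add[OF c] and scale = c_scale[OF c]
    and lin = c_linear[OF c]
  have square: "c v (c v x) = - ((v \<bullet> v) *\<^sub>R x)" if "x \<in> V" for v x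
  proof -
    have "2 *\<^sub>R c v (c v x) = 2 *\<^sub>R (- ((v \<bullet> v) *\<^sub>R x))"
      using c_rel[OF c that, of v v] by (simp add: scaleR_2)
    then show ?thesis by (simp only: scaleR_cancel_left) simp
  qed
  have sub: "W = {0} \<or> W = V"
    if "W \<subseteq> V" and W: "subspace W" and inv: "\<And>v x. x \<in> W \<Longrightarrow> c v x \<in> W" for W
  proof (cases "W = {0}")
    case False
    have unscale: "\<Omega> \<in> W" if "r *\<^sub>R \<Omega> \<in> W" "r \<noteq> 0" for r
      using subspace_scale[OF W that(1), of "inverse r"] that(2) by simp
    have reach: "\<Omega> \<in> W" if x: "x \<in> W" "c w \<Omega> + t = x" "\<And>v. \<exists>u. c v t = c u \<Omega>" "t \<in> V" "w \<noteq> 0"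
      for x w t
    proof -
      obtain u where u: "c w t = c u \<Omega>" using x(3) by blast
      define b where "b = - (w \<bullet> w)"
      have y: "c w x = b *\<^sub>R \<Omega> + c u \<Omega>"
        unfolding x(2)[symmetric] by (simp add: add closed \<Omega> \<open>t \<in> V\<close> square u b_def)
      \<comment> \<open>\<open>b + c u\<close> behaves like a complex number with real part \<open>b\<close>; its conjugate makes it real.\<close>
      have "b *\<^sub>R c w x - c u (c w x) = (b * b + u \<bullet> u) *\<^sub>R \<Omega>"
        unfolding y by (simp add: add scale closed \<Omega> subspace_scale[OF V] square algebra_simps)
      then have "(b * b + u \<bullet> u) *\<^sub>R \<Omega> \<in> W"
        using x(1) by (metis inv subspace_diff[OF W] subspace_scale[OF W])
      moreover have "b * b + u \<bullet> u \<noteq> 0"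
        using \<open>w \<noteq> 0\<close> by (simp add: b_def add_pos_nonneg order_less_imp_not_eq2 zero_less_mult_iff)
      ultimately show ?thesis by (rule unscale)
    qed
    obtain x where x: "x \<in> W" "x \<noteq> 0"
      using False subspace_0[OF W] by blast
    then have xV: "x \<in> V" using \<open>W \<subseteq> V\<close> by blast
    obtain w where w: "\<And>v. \<exists>u. c v (x - c w \<Omega>) = c u \<Omega>"
      using dec[OF \<open>x \<in> V\<close>] by blast
    have "\<Omega> \<in> W"
    proof (cases "w = 0")
      case True
      define e :: "(real, 'b) vec" where "e = axis undefined 1"
      have "c w \<Omega> = 0" using linear_0[OF lin[OF \<Omega>(1)]] True by simp
      then obtain u where u: "c e x = c u \<Omega>" using w[of e] by auto
      have "c e (c e x) \<noteq> 0"
        using square[OF \<open>x \<in> V\<close>, of e] x(2) by (simp add: e_def inner_axis_axis)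
      then have "c e x \<noteq> 0" using scale[OF \<open>x \<in> V\<close>, of e 0] scale[of 0 e 0] subspace_0[OF V] by auto
      then have "u \<noteq> 0" using u linear_0[OF lin[OF \<Omega>(1)]] by auto
      have "c u (c e x) = - (u \<bullet> u) *\<^sub>R \<Omega>" by (simp add: u square \<Omega>)
      then show ?thesis
        using inv[OF inv[OF x(1), of e], of u] \<open>u \<noteq> 0\<close> by (intro unscale[of "- (u \<bullet> u)"]) simp_all
    next
      case False
      show ?thesis
        by (rule reach[OF x(1), of w "x - c w \<Omega>"])
          (use w False in \<open>simp_all add: subspace_diff[OF V] xV closed \<Omega>\<close>)
    qed
    have "y \<in> W" if y: "y \<in> V" for y
    proof -
      define e :: "(real, 'b) vec" where "e = axis undefined 1"
      obtain w where w: "\<And>v. \<exists>u. c v (y - c w \<Omega>) = c u \<Omega>"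
        using dec[OF y] by blast
      obtain u where u: "c e (y - c w \<Omega>) = c u \<Omega>" using w by blast
      have "y - c w \<Omega> = - c e (c e (y - c w \<Omega>))"
        by (subst square) (simp_all add: subspace_diff[OF V] y closed \<Omega> e_def inner_axis_axis)
      then have "y = c w \<Omega> - c e (c u \<Omega>)" by (simp add: u algebra_simps)
      then show ?thesis
        using \<open>\<Omega> \<in> W\<close> by (metis inv subspace_diff[OF W])
    qed
    then show ?thesis using \<open>W \<subseteq> V\<close> by blast
  qed simp
  have "irreducible_clifford_module V \<rho>" if \<rho>: "extends_to_module V c \<rho>" for \<rho>
    unfolding irreducible_clifford_module_def
  proof (intro conjI allI impI)
    show "clifford_module V \<rho>" using \<rho> by (simp add: extends_to_module_def)
    show "V \<noteq> {0}" using \<Omega> by blast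
    fix W assume "W \<subseteq> V" and W: "subspace W \<and> (\<forall>a. \<forall>x\<in>W. \<rho> a x \<in> W)"
    have inv: "c v x \<in> W" if "x \<in> W" for v x
      using W that \<rho> \<open>W \<subseteq> V\<close> unfolding extends_to_module_def by (metis subsetD)
    show "W = {0} \<or> W = V"
      by (rule sub[OF \<open>W \<subseteq> V\<close> conjunct1[OF W] inv])
  qed
  then show ?thesis
    unfolding makes_irreducible_module_def using extends_to_module_exists[OF c] by blast
qed


section \<open>Dimensions one and two\<close>

lemma clifford_map_c12: "clifford_map UNIV c12"
proof (rule clifford_mapI)
  fix v :: "real ^ ('n::{finite,linorder})" and x :: "'n multivector"
  show "c12 v (c12 v x) = - ((v \<bullet> v) *\<^sub>R x)"
    unfolding contract_wedge[symmetric] c12_def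
    by (simp add: bilinear_rsub[OF bilinear_vec_wedge] bilinear_rsub[OF bilinear_contract]
        vec_wedge_vec_wedge contract_contract)
  show "linear (\<lambda>v. c12 v x)"
    unfolding c12_def using bilinear_vec_wedge bilinear_contract
    by (auto simp: bilinear_def intro!: linear_compose_sub)
qed (auto simp: c12_def bilinear_radd[OF bilinear_vec_wedge] bilinear_radd[OF bilinear_contract]
    bilinear_rmul[OF bilinear_vec_wedge] bilinear_rmul[OF bilinear_contract] algebra_simps)

lemma c12_one: "c12 v (axis {} 1) = vec_mv v"
proof -
  have "contract v (axis {} 1) = 0"
    by (simp add: vec_eq_iff contract_def axis_def)
  then show ?thesis by (simp add: c12_def vec_wedge_one)
qed

lemma makes_irreducible_module_c12:
  assumes "CARD('n) \<le> 2"
  shows "makes_irreducible_module UNIV (c12 :: real ^ ('n::{finite,linorder}) \<Rightarrow> 'n multivector \<Rightarrow> 'n multivector)"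
proof (rule makes_irreducible_moduleI[OF clifford_map_c12])
  show "axis {} 1 \<noteq> (0 :: 'n multivector)" by (simp add: axis_eq_0_iff)
  fix x :: "'n multivector"
  define t where "t = x - vec_mv (mv_vec x)"
  have t: "t $ {i} = 0" for i by (simp add: t_def vec_mv_nth mv_vec_def)
  \<comment> \<open>\<open>t\<close> has no part of degree one, so \<open>c12 v t\<close> is zero in the degrees 0 and 2, and there is no degree
    above 2.\<close>
  have "c12 v t \<in> grade 1" for v
    unfolding grade_def
  proof (intro CollectI allI impI, rule ccontr)
    fix K assume nz: "c12 v t $ K \<noteq> 0" and "card K \<noteq> 1"
    moreover have "card K \<le> 2"
      using card_mono[OF finite subset_UNIV, of K] assms by linarith
    ultimately consider "K = {}" | "card K = 2"
      by (metis One_nat_def Suc_1 card_0_eq finite le_SucE le_zero_eq)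
    then show False
    proof cases
      case 1
      then show False using nz by (simp add: c12_def vec_wedge_nth contract_def t)
    next
      case 2
      then have "K = UNIV" using assms card_mono[OF finite subset_UNIV, of K]
        by (metis card_subset_eq finite le_antisym subset_UNIV)
      moreover have "t $ (K - {i}) = 0" if "i \<in> K" for i
      proof -
        have "card (K - {i}) = 1" using 2 that by simp
        then show ?thesis using t by (metis card_1_singletonE)
      qed
      ultimately show False using nz by (simp add: c12_def vec_wedge_nth contract_def)
    qed
  qed
  then have "c12 v t = c12 (mv_vec (c12 v t)) (axis {} 1)" for v
    by (simp only: c12_one vec_mv_mv_vec)
  then show "\<exists>w. \<forall>v. \<exists>u. c12 v (x - c12 w (axis {} 1)) = c12 u (axis {} 1)"
    unfolding t_def c12_one by blast
qed simp


section \<open>Dimension three\<close>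

text \<open>The cross product \<open>\<star>(v \<and> w)\<close> is orthogonal to \<open>v\<close>: its inner product with \<open>v\<close> is the coefficient
  of \<open>v \<and> \<star>\<star>(v \<and> w) = v \<and> v \<and> w\<close>.\<close>
lemma inner_cross:
  fixes v w :: "real ^ ('n::{finite,linorder})"
  assumes n: "CARD('n) = 3"
  shows "v \<bullet> mv_vec (hodge (vec_mv v \<and>\<^sub>m vec_mv w)) = 0"
proof -
  let ?\<eta> = "vec_mv v \<and>\<^sub>m vec_mv w"
  have \<eta>: "?\<eta> \<in> grade 2"
    using grade_vec_wedge[OF grade_vec_mv] by (simp add: numeral_2_eq_2)
  have "hodge ?\<eta> \<in> grade 1" using grade_hodge[OF \<eta>] by (simp add: n)
  from wedge_hodge[OF grade_vec_mv this, of v]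
  have "(vec_mv v \<bullet> hodge ?\<eta>) *\<^sub>R axis UNIV 1 = (0 :: 'n multivector)"
    by (simp add: hodge_hodge[OF \<eta>] n vec_wedge_vec_wedge)
  then have "vec_mv v \<bullet> hodge ?\<eta> = 0" by (simp add: axis_eq_0_iff)
  then show ?thesis
    by (simp only: inner_vec_mv[symmetric, of v] vec_mv_c3[OF n])
qed

text \<open>The triple product formula for \<open>v \<times> (v \<times> w)\<close>, which is \<open>- \<iota>\<^sub>v (v \<and> w)\<close>.\<close>
lemma cross_cross:
  fixes v w :: "real ^ ('n::{finite,linorder})"
  assumes n: "CARD('n) = 3"
  shows "mv_vec (hodge (vec_mv v \<and>\<^sub>m hodge (vec_mv v \<and>\<^sub>m vec_mv w)))
    = (v \<bullet> w) *\<^sub>R v - (v \<bullet> v) *\<^sub>R w"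
proof -
  have \<eta>: "vec_mv v \<and>\<^sub>m vec_mv w \<in> grade 2"
    using grade_vec_wedge[OF grade_vec_mv] by (simp add: numeral_2_eq_2)
  have "hodge (vec_mv v \<and>\<^sub>m hodge (vec_mv v \<and>\<^sub>m vec_mv w))
      = vec_mv ((v \<bullet> w) *\<^sub>R v - (v \<bullet> v) *\<^sub>R w)"
    by (simp add: hodge_wedge_hodge[OF \<eta>] n contract_vec_wedge_vec linear_diff[OF linear_vec_mv]
        linear_scale[OF linear_vec_mv])
  then show ?thesis by simp
qed

lemma clifford_map_c3:
  assumes n: "CARD('n) = 3"
  shows "clifford_map UNIV (c3 :: real ^ ('n::{finite,linorder}) \<Rightarrow> _)"
proof (rule clifford_mapI)
  fix v :: "(real, 'n) vec" and x :: "real \<times> (real, 'n) vec"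
  obtain a w where x: "x = (a, w)" by (cases x)
  show "c3 v (c3 v x) = - ((v \<bullet> v) *\<^sub>R x)"
    by (simp add: c3_def x inner_cross[OF n] cross_cross[OF n] vec_mv_c3[OF n] inner_add_right
        linear_add[OF linear_vec_mv] linear_scale[OF linear_vec_mv] vec_wedge_self
        bilinear_radd[OF bilinear_vec_wedge] bilinear_rmul[OF bilinear_vec_wedge])
  show "linear (\<lambda>v. c3 v x)"
    by (rule linearI) (simp_all add: x c3_def inner_add_left algebra_simps
        bilinear_ladd[OF bilinear_vec_wedge] bilinear_lmul[OF bilinear_vec_wedge]
        linear_add[OF linear_hodge] linear_scale[OF linear_hodge]
        linear_add[OF linear_mv_vec] linear_scale[OF linear_mv_vec])
next
  fix v :: "(real, 'n) vec" and x y :: "real \<times> (real, 'n) vec" and r :: real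
  note lin = linear_add[OF linear_hodge] linear_scale[OF linear_hodge]
    linear_add[OF linear_mv_vec] linear_scale[OF linear_mv_vec]
    linear_add[OF linear_vec_mv] linear_scale[OF linear_vec_mv]
    bilinear_radd[OF bilinear_vec_wedge] bilinear_rmul[OF bilinear_vec_wedge]
  show "c3 v (x + y) = c3 v x + c3 v y" "c3 v (r *\<^sub>R x) = r *\<^sub>R c3 v x"
    by (cases x; cases y; simp add: c3_def inner_add_right algebra_simps lin)+
qed simp_all

lemma makes_irreducible_module_c3:
  assumes n: "CARD('n) = 3"
  shows "makes_irreducible_module UNIV (c3 :: real ^ ('n::{finite,linorder}) \<Rightarrow> _)"
proof (rule makes_irreducible_moduleI[OF clifford_map_c3[OF n]])
  fix x :: "real \<times> (real, 'n) vec"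
  obtain a w where x: "x = (a, w)" by (cases x)
  have scalar: "c3 v (r, 0) = (0, r *\<^sub>R v)" for r and v :: "(real, 'n) vec"
    by (simp add: c3_def linear_0[OF linear_vec_mv] bilinear_rzero[OF bilinear_vec_wedge]
        linear_0[OF linear_hodge] linear_0[OF linear_mv_vec])
  have "c3 v (x - c3 w (1, 0)) = c3 (a *\<^sub>R v) (1, 0)" for v :: "(real, 'n) vec"
    by (simp add: x scalar)
  then show "\<exists>w. \<forall>v. \<exists>u. c3 v (x - c3 w (1, 0)) = c3 u (1, 0)" by blast
qed (simp_all add: zero_prod_def)


section \<open>Dimension four\<close>

context
  assumes n: "CARD('n::{finite,linorder}) = 4"
begin

lemma asd_part_in:
  fixes \<omega> :: "'n multivector"
  assumes "\<omega> \<in> grade 2"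
  shows "(1 / 2) *\<^sub>R (\<omega> - hodge \<omega>) \<in> anti_self_dual"
proof -
  have "hodge \<omega> \<in> grade 2" using grade_hodge[OF assms] by (simp add: n)
  then show ?thesis
    using assms by (simp add: anti_self_dual_def subspace_scale subspace_diff subspace_grade
        linear_scale[OF linear_hodge] linear_diff[OF linear_hodge] hodge_hodge[OF assms] n
        scaleR_right_diff_distrib)
qed

text \<open>The star is an isometric involution of \<open>\<and>\<^sup>2\<close>, so its eigenspaces for \<open>1\<close> and \<open>-1\<close> are orthogonal.\<close>
lemma orth_proj_anti_self_dual:
  fixes \<omega> :: "'n multivector"
  assumes "\<omega> \<in> grade 2"
  shows "orth_proj anti_self_dual \<omega> = (1 / 2) *\<^sub>R (\<omega> - hodge \<omega>)"
proof (rule orth_proj_unique[OF subspace_anti_self_dual asd_part_in[OF assms]])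
  fix s :: "'n multivector" assume "s \<in> anti_self_dual"
  then have "hodge \<omega> \<bullet> s = - (hodge \<omega> \<bullet> hodge s)" by (simp add: anti_self_dual_def)
  then have "(\<omega> + hodge \<omega>) \<bullet> s = 0" by (simp add: inner_add_left inner_hodge_hodge)
  moreover have "\<omega> - (1 / 2) *\<^sub>R (\<omega> - hodge \<omega>) = (1 / 2) *\<^sub>R (\<omega> + hodge \<omega>)"
    by (simp add: vec_eq_iff field_simps)
  ultimately show "orthogonal (\<omega> - (1 / 2) *\<^sub>R (\<omega> - hodge \<omega>)) s"
    by (simp only: orthogonal_def inner_scaleR_left)
qed

lemma hodge_wedge_anti_self_dual:
  fixes \<tau> :: "'n multivector"
  assumes "\<tau> \<in> anti_self_dual"
  shows "hodge (vec_mv v \<and>\<^sub>m \<tau>) = - contract v \<tau>"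
proof -
  have "\<tau> \<in> grade 2" and "hodge \<tau> = - \<tau>"
    using assms by (auto simp: anti_self_dual_def)
  then have "hodge (vec_mv v \<and>\<^sub>m - \<tau>) = contract v \<tau>"
    using hodge_wedge_hodge[of \<tau> 2 v] by (simp add: n)
  then show ?thesis
    by (simp add: bilinear_rneg[OF bilinear_vec_wedge] linear_neg[OF linear_hodge]
        minus_equation_iff)
qed

lemma c4_eq:
  fixes v w :: "(real, 'n) vec"
  assumes "\<tau> \<in> anti_self_dual"
  shows "c4 v (a, w, \<tau>) = (- (v \<bullet> w), a *\<^sub>R v - 2 *\<^sub>R mv_vec (contract v \<tau>),
    (1 / 2) *\<^sub>R (vec_mv v \<and>\<^sub>m vec_mv w - hodge (vec_mv v \<and>\<^sub>m vec_mv w)))"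
proof -
  have "vec_mv v \<and>\<^sub>m vec_mv w \<in> grade 2"
    using grade_vec_wedge[OF grade_vec_mv] by (simp add: numeral_2_eq_2)
  moreover have "hodge (vec_mv v \<and>\<^sub>m \<tau>) - contract v \<tau> = - 2 *\<^sub>R contract v \<tau>"
    by (simp add: hodge_wedge_anti_self_dual[OF assms] scaleR_2)
  ultimately show ?thesis
    by (simp add: c4_def orth_proj_anti_self_dual linear_scale[OF linear_mv_vec]
        linear_neg[OF linear_mv_vec])
qed

text \<open>The self-dual correction in the projection of \<open>v \<and> w\<close> is invisible to \<open>\<iota>\<^sub>v\<close>, as \<open>\<iota>\<^sub>v \<star>(v \<and> w)\<close> is the
  star of \<open>v \<and> v \<and> w\<close> up to sign.\<close>
lemma contract_asd_part:
  fixes v w :: "(real, 'n) vec"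
  shows "contract v (vec_mv v \<and>\<^sub>m vec_mv w - hodge (vec_mv v \<and>\<^sub>m vec_mv w))
    = (v \<bullet> v) *\<^sub>R vec_mv w - (v \<bullet> w) *\<^sub>R vec_mv v"
proof -
  let ?\<eta> = "vec_mv v \<and>\<^sub>m vec_mv w"
  have \<eta>: "?\<eta> \<in> grade 2"
    using grade_vec_wedge[OF grade_vec_mv] by (simp add: numeral_2_eq_2)
  then have "hodge ?\<eta> \<in> grade 2" using grade_hodge[OF \<eta>] by (simp add: n)
  from hodge_wedge_hodge[OF this, of v] have "contract v (hodge ?\<eta>) = 0"
    by (simp add: n hodge_hodge[OF \<eta>] vec_wedge_vec_wedge linear_0[OF linear_hodge])
  then show ?thesis
    by (simp add: bilinear_rsub[OF bilinear_contract] contract_vec_wedge_vec)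
qed

text \<open>By \<open>hodge_wedge_hodge\<close> in degree 3, \<open>\<star>(v \<and> \<iota>\<^sub>v \<tau>) = - \<iota>\<^sub>v (v \<and> \<tau>)\<close>, so the left-hand side is the
  anticommutator of \<open>contract_wedge\<close>. This is the \<open>\<and>\<^sup>-\<close> part of the Clifford relation.\<close>
lemma asd_part_wedge_contract:
  fixes v :: "(real, 'n) vec"
  assumes "\<tau> \<in> anti_self_dual"
  shows "vec_mv v \<and>\<^sub>m contract v \<tau> - hodge (vec_mv v \<and>\<^sub>m contract v \<tau>) = (v \<bullet> v) *\<^sub>R \<tau>"
proof -
  have "vec_mv v \<and>\<^sub>m \<tau> \<in> grade 3"
    using grade_vec_wedge[of \<tau> 2 v] assms by (simp add: anti_self_dual_def)
  from hodge_wedge_hodge[OF this, of v]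
  have "hodge (vec_mv v \<and>\<^sub>m contract v \<tau>) = - contract v (vec_mv v \<and>\<^sub>m \<tau>)"
    by (simp add: n hodge_wedge_anti_self_dual[OF assms] bilinear_rneg[OF bilinear_vec_wedge]
        linear_neg[OF linear_hodge] eq_neg_iff_add_eq_0 neg_eq_iff_add_eq_0)
  then show ?thesis
    using contract_wedge[of v \<tau>] by (simp add: add.commute)
qed

lemma clifford_map_c4:
  "clifford_map (UNIV \<times> UNIV \<times> anti_self_dual) (c4 :: (real, 'n) vec \<Rightarrow> _)"
proof (rule clifford_mapI)
  show V: "subspace (UNIV \<times> UNIV \<times> anti_self_dual :: (real \<times> (real, 'n) vec \<times> 'n multivector) set)"
    by (intro subspace_Times subspace_UNIV subspace_anti_self_dual)
  note lin = linear_add[OF linear_hodge] linear_scale[OF linear_hodge]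
    linear_add[OF linear_mv_vec] linear_scale[OF linear_mv_vec]
    bilinear_ladd[OF bilinear_vec_wedge] bilinear_lmul[OF bilinear_vec_wedge]
    bilinear_ladd[OF bilinear_contract] bilinear_lmul[OF bilinear_contract]
    bilinear_radd[OF bilinear_vec_wedge] bilinear_rmul[OF bilinear_vec_wedge]
    bilinear_radd[OF bilinear_contract] bilinear_rmul[OF bilinear_contract]
  note vec = linear_add[OF linear_vec_mv] linear_scale[OF linear_vec_mv]
  fix v :: "(real, 'n) vec" and x :: "real \<times> (real, 'n) vec \<times> 'n multivector"
  assume "x \<in> UNIV \<times> UNIV \<times> anti_self_dual"
  then obtain a w \<tau> where x: "x = (a, w, \<tau>)" and \<tau>: "\<tau> \<in> anti_self_dual" by blast
  define \<rho> where "\<rho> = (1 / 2) *\<^sub>R (vec_mv v \<and>\<^sub>m vec_mv w - hodge (vec_mv v \<and>\<^sub>m vec_mv w))"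
  have \<rho>: "\<rho> \<in> anti_self_dual"
    unfolding \<rho>_def using grade_vec_wedge[OF grade_vec_mv]
    by (intro asd_part_in) (simp add: numeral_2_eq_2)
  define u where "u = mv_vec (contract v \<tau>)"
  have c4_x: "c4 v x = (- (v \<bullet> w), a *\<^sub>R v - 2 *\<^sub>R u, \<rho>)"
    by (simp add: x c4_eq[OF \<tau>] \<rho>_def u_def)
  then show closed: "c4 v x \<in> UNIV \<times> UNIV \<times> anti_self_dual"
    by (simp add: \<rho>)
  have "contract v \<tau> \<in> grade 1"
    using \<tau> by (intro grade_contract) (simp add: anti_self_dual_def numeral_2_eq_2)
  then have vec_u: "vec_mv u = contract v \<tau>" by (simp add: u_def vec_mv_mv_vec)
  have "u \<bullet> v = 0"
    by (simp only: inner_vec_mv[symmetric, of u] vec_u contract_adjoint vec_wedge_self inner_zero_right)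
  then have fst: "v \<bullet> (a *\<^sub>R v - 2 *\<^sub>R u) = a * (v \<bullet> v)"
    by (simp add: inner_diff_right inner_commute)
  have "2 *\<^sub>R contract v \<rho> = vec_mv ((v \<bullet> v) *\<^sub>R w - (v \<bullet> w) *\<^sub>R v)"
    by (simp add: \<rho>_def bilinear_rmul[OF bilinear_contract] contract_asd_part
        linear_diff[OF linear_vec_mv] linear_scale[OF linear_vec_mv])
  then have snd: "2 *\<^sub>R mv_vec (contract v \<rho>) = (v \<bullet> v) *\<^sub>R w - (v \<bullet> w) *\<^sub>R v"
    by (simp add: linear_scale[OF linear_mv_vec, symmetric])
  have "vec_mv v \<and>\<^sub>m vec_mv (a *\<^sub>R v - 2 *\<^sub>R u) = - 2 *\<^sub>R (vec_mv v \<and>\<^sub>m contract v \<tau>)"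
    by (simp add: linear_diff[OF linear_vec_mv] linear_scale[OF linear_vec_mv] vec_u
        bilinear_rsub[OF bilinear_vec_wedge] bilinear_rmul[OF bilinear_vec_wedge] vec_wedge_self)
  then have thd: "(1 / 2) *\<^sub>R (vec_mv v \<and>\<^sub>m vec_mv (a *\<^sub>R v - 2 *\<^sub>R u)
      - hodge (vec_mv v \<and>\<^sub>m vec_mv (a *\<^sub>R v - 2 *\<^sub>R u))) = - ((v \<bullet> v) *\<^sub>R \<tau>)"
    by (simp add: linear_scale[OF linear_hodge] linear_neg[OF linear_hodge]
        asd_part_wedge_contract[OF \<tau>, of v, symmetric] algebra_simps)
  show "c4 v (c4 v x) = - ((v \<bullet> v) *\<^sub>R x)"
    unfolding c4_x c4_eq[OF \<rho>] fst snd thd by (simp add: x)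
  show "c4 v (r *\<^sub>R x) = r *\<^sub>R c4 v x" for r
    using subspace_scale[OF subspace_anti_self_dual \<tau>]
    by (simp add: x \<tau> c4_eq lin vec algebra_simps)
  show "linear (\<lambda>v. c4 v x)"
    unfolding x
    by (rule linearI) (simp_all add: \<tau> c4_eq lin algebra_simps)
  fix y :: "real \<times> (real, 'n) vec \<times> 'n multivector"
  assume "y \<in> UNIV \<times> UNIV \<times> anti_self_dual"
  then obtain b z \<sigma> where y: "y = (b, z, \<sigma>)" and \<sigma>: "\<sigma> \<in> anti_self_dual" by blast
  show "c4 v (x + y) = c4 v x + c4 v y"
    using subspace_add[OF subspace_anti_self_dual \<tau> \<sigma>]
    by (simp add: x y \<tau> \<sigma> c4_eq lin vec algebra_simps)
qed

lemma makes_irreducible_module_c4: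
  "makes_irreducible_module (UNIV \<times> UNIV \<times> anti_self_dual) (c4 :: (real, 'n) vec \<Rightarrow> _)"
proof (rule makes_irreducible_moduleI[OF clifford_map_c4])
  note zero = subspace_0[OF subspace_anti_self_dual]
  show "(1, 0, 0) \<in> UNIV \<times> UNIV \<times> anti_self_dual" by (simp add: zero)
  fix x :: "real \<times> (real, 'n) vec \<times> 'n multivector"
  assume "x \<in> UNIV \<times> UNIV \<times> anti_self_dual"
  then obtain a w \<tau> where x: "x = (a, w, \<tau>)" and \<tau>: "\<tau> \<in> anti_self_dual" by blast
  have even: "c4 v (r, 0, \<sigma>) = (0, r *\<^sub>R v - 2 *\<^sub>R mv_vec (contract v \<sigma>), 0)"
    if "\<sigma> \<in> anti_self_dual" for r \<sigma> and v :: "(real, 'n) vec"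
    by (simp add: c4_eq that linear_0[OF linear_vec_mv] bilinear_rzero[OF bilinear_vec_wedge]
        linear_0[OF linear_hodge])
  then have one: "c4 v (1, 0, 0) = (0, v, 0)" for v :: "(real, 'n) vec"
    by (simp add: zero bilinear_rzero[OF bilinear_contract] linear_0[OF linear_mv_vec])
  have "c4 v (x - c4 w (1, 0, 0)) = c4 (a *\<^sub>R v - 2 *\<^sub>R mv_vec (contract v \<tau>)) (1, 0, 0)"
    for v :: "(real, 'n) vec"
    by (simp add: x one even[OF \<tau>])
  then show "\<exists>w. \<forall>v. \<exists>u. c4 v (x - c4 w (1, 0, 0)) = c4 u (1, 0, 0)" by blast
qed (simp add: zero_prod_def)

end


section \<open>Irreducible modules in dimensions one to four\<close>

theorem mainTheorem3:
  shows "(CARD('n) = 1 \<or> CARD('n) = 2 \<longrightarrow>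
      clifford_map UNIV (c12 :: real ^ ('n::{finite,linorder}) \<Rightarrow> 'n multivector \<Rightarrow> 'n multivector) \<and>
      makes_irreducible_module UNIV (c12 :: (real, 'n) vec \<Rightarrow> 'n multivector \<Rightarrow> 'n multivector)) \<and>
    (CARD('n) = 3 \<longrightarrow>
      clifford_map UNIV (c3 :: (real, 'n) vec \<Rightarrow> real \<times> (real, 'n) vec \<Rightarrow> real \<times> (real, 'n) vec) \<and>
      makes_irreducible_module UNIV
        (c3 :: (real, 'n) vec \<Rightarrow> real \<times> (real, 'n) vec \<Rightarrow> real \<times> (real, 'n) vec)) \<and>
    (CARD('n) = 4 \<longrightarrow>
      clifford_map (UNIV \<times> UNIV \<times> anti_self_dual) (c4 :: (real, 'n) vec \<Rightarrow> _) \<and>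
      makes_irreducible_module (UNIV \<times> UNIV \<times> anti_self_dual) (c4 :: (real, 'n) vec \<Rightarrow> _))"
  by (auto intro: clifford_map_c12 makes_irreducible_module_c12 clifford_map_c3
      makes_irreducible_module_c3 clifford_map_c4 makes_irreducible_module_c4)

end
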